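(* Let $\Omega\subset\mathbb{R}^n$ be a bounded measurable set with $|\Omega|=1$, and let $B,k>0$. Fix $x_0\in\Omega$ and assume that $u_0\in L^\infty(\Omega)$ satisfies $$0\le u_0(x)<u_0(x_0)\qquad\text{for all }x\ne x_0$$ and $$A_0\equiv\int_\Omega\Big(\frac{u_0(x_0)u_0(x)}{u_0(x_0)-u_0(x)}\Big)^2dx<\infty .$$ Let $\xi_0\in\mathbb{R}$ be such that $$\frac{1}{B+k}\min\Big\{\xi_0,\frac{B}{A_0+B}\Big\}>\frac1{u_0(x_0)} .$$ Then the solution of the system $$u_t=-(B+k)u+u^2\xi\quad(x\in\Omega,\ t>0),\qquad \xi_t=-\xi\int_\Omega u^2\,dx+B(1-\xi)\quad(t>0)$$ with initial conditions $u(x,0)=u_0(x)$ and $\xi(0)=\xi_0$ blows up in finite time at $x_0$ in the following sense. There exists $T_{max}\in(0,\infty)$ such that: \begin{itemize} \item the solution $(u(x,t),\xi(t))$ exists on $\Omega\times[0,T_{max})$ and it is continuous on $[0,T_{max})$ for every fixed $x\in\Omega$; \item $u(x_0,t)\to+\infty$ when $t\to T_{max}$; \item the following estimates hold for all $(x,t)\in(\Omega\setminus\{x_0\})\times[0,T_{max})$: $$0\le u(x,t)\le\frac{u_0(x_0)u_0(x)e^{-t(B+k)}}{u_0(x_0)-u_0(x)}$$ and $$\min\Big\{\xi_0,\frac{B}{A_0+B}\Big\}\le\xi(t)\le\max\{\xi_0,1\}.$$ \end{itemize}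
   Context: The unknowns are $u=u(x,t)$ and $\xi=\xi(t)$. Here $u_0$ is a bounded measurable function defined at every point of $\Omega$, and the equation for $u$ is understood pointwise: for every $x\in\Omega$, $u(x,\cdot)$ solves the corresponding ordinary differential equation with the given $\xi(\cdot)$, with $u$ bounded on $\Omega\times[0,T]$ for each $T<T_{max}$. *)

theory Defs
  imports "HOL-Analysis.Analysis"
begin

text \<open>
  The equation for \<open>u\<close> is required at every point of \<open>\<Omega>\<close>, not almost everywhere. Measurability of
  \<open>u(\<cdot>,t)\<close> and local-in-time boundedness ensure that the integral in the equation for \<open>\<xi>\<close> is a
  genuine one. The equations hold for \<open>t > 0\<close>; continuity on \<open>[0,T)\<close> attaches the initial values.
\<close>

definition solution_on ::
  "'a::euclidean_space set \<Rightarrow> real \<Rightarrow> real \<Rightarrow> ('a \<Rightarrow> real) \<Rightarrow> real \<Rightarrow> real \<Rightarrow>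
    ('a \<Rightarrow> real \<Rightarrow> real) \<Rightarrow> (real \<Rightarrow> real) \<Rightarrow> bool"
where
  "solution_on \<Omega> B k u\<^sub>0 \<xi>\<^sub>0 T u \<xi> \<longleftrightarrow>
     (\<forall>x\<in>\<Omega>. u x 0 = u\<^sub>0 x) \<and> \<xi> 0 = \<xi>\<^sub>0 \<and>
     (\<forall>x\<in>\<Omega>. continuous_on {0..<T} (u x)) \<and> continuous_on {0..<T} \<xi> \<and>
     (\<forall>t\<in>{0..<T}. (\<lambda>x. u x t) \<in> borel_measurable (lebesgue_on \<Omega>)) \<and>
     (\<forall>S\<in>{0..<T}. \<exists>C. \<forall>x\<in>\<Omega>. \<forall>t\<in>{0..S}. \<bar>u x t\<bar> \<le> C) \<and>
     (\<forall>x\<in>\<Omega>. \<forall>t\<in>{0<..<T}.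
        (u x has_real_derivative (- (B + k) * u x t + (u x t)\<^sup>2 * \<xi> t)) (at t)) \<and>
     (\<forall>t\<in>{0<..<T}.
        (\<xi> has_real_derivative
          (- \<xi> t * (LINT x|lebesgue_on \<Omega>. (u x t)\<^sup>2) + B * (1 - \<xi> t))) (at t))"

text \<open>
  ``The solution'' on its maximal interval \<open>[0,T)\<close>: a solution of which every other solution, on
  whatever interval \<open>[0,S)\<close>, is a restriction.
\<close>

definition maximal_solution ::
  "'a::euclidean_space set \<Rightarrow> real \<Rightarrow> real \<Rightarrow> ('a \<Rightarrow> real) \<Rightarrow> real \<Rightarrow> real \<Rightarrow>
    ('a \<Rightarrow> real \<Rightarrow> real) \<Rightarrow> (real \<Rightarrow> real) \<Rightarrow> bool"
where
  "maximal_solution \<Omega> B k u\<^sub>0 \<xi>\<^sub>0 T u \<xi> \<longleftrightarrow>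
     solution_on \<Omega> B k u\<^sub>0 \<xi>\<^sub>0 T u \<xi> \<and>
     (\<forall>S v \<eta>. 0 < S \<and> solution_on \<Omega> B k u\<^sub>0 \<xi>\<^sub>0 S v \<eta> \<longrightarrow>
        S \<le> T \<and> (\<forall>t\<in>{0..<S}. \<eta> t = \<xi> t \<and> (\<forall>x\<in>\<Omega>. v x t = u x t)))"

end

theory Submission
  imports Defs
begin

text \<open>
  With \<open>a = B + k\<close> and \<open>J t\<close> the integral of \<open>exp (- a s) * \<xi> s\<close> over \<open>[0,t]\<close>, the equation for \<open>u\<close>
  integrates to \<open>u x t = exp (- a t) * u\<^sub>0 x / (1 - u\<^sub>0 x * J t)\<close>, so blow-up at \<open>x\<^sub>0\<close> means that \<open>J\<close>
  reaches \<open>R = 1 / u\<^sub>0 x\<^sub>0\<close>, and the system becomes a planar one for \<open>(J, \<xi>)\<close> with the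
  coefficient \<open>G j\<close>, the integral of \<open>(u\<^sub>0 x / (1 - u\<^sub>0 x * j))\<^sup>2\<close>. This \<open>G\<close> is continuous on the closed
  interval \<open>[0,R]\<close> and bounded by \<open>A\<^sub>0\<close>, but possibly not Lipschitz at \<open>R\<close>. Taking \<open>j = J t\<close> as
  the independent variable, \<open>w = exp (- a t)\<close> and \<open>\<xi>\<close> satisfy \<open>w' = - a / \<xi>\<close> and
  \<open>\<xi>' = - w * G j + B * (1 - \<xi>) / (w * \<xi>)\<close>, whose right-hand side needs only continuity of \<open>G\<close>. The
  bounds \<open>m \<le> \<xi> \<le> max \<xi>\<^sub>0 1\<close>, where \<open>m = min \<xi>\<^sub>0 (B / (A\<^sub>0 + B))\<close>, are invariant, and then
  \<open>w \<ge> 1 - a * R / m > 0\<close> on \<open>[0,R]\<close>: this is exactly the smallness hypothesis. So the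
  solution reaches \<open>j = R\<close> at the finite time \<open>- ln (w R) / a\<close>.

  Any other solution, composed with the curve \<open>j \<mapsto> (w j, \<xi> j)\<close>, differs from it by a solution of a
  homogeneous linear system with zero initial data, whence uniqueness and maximality.
\<close>

section \<open>Global existence for ordinary differential equations with a Lipschitz right-hand
  side\<close>

text \<open>Banach's fixed point theorem in an exponentially weighted sup norm. Since the Lipschitz
  constant holds on the whole space, one contraction covers all of \<open>{0..T}\<close> and no
  continuation argument is needed. Only existence is stated; uniqueness is obtained later, for the
  planar system, from \<open>gronwall_zero\<close>.\<close>

lemma picard_lindeloef_global:
  fixes f :: "real \<Rightarrow> 'a::banach \<Rightarrow> 'a"
  assumes T: "0 \<le> T" and L: "0 < L"
    and cont: "continuous_on ({0..T} \<times> UNIV) (\<lambda>(t, x). f t x)"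
    and lip: "\<And>t x y. t \<in> {0..T} \<Longrightarrow> norm (f t x - f t y) \<le> L * norm (x - y)"
  obtains y where "y 0 = y\<^sub>0"
    and "\<And>t. t \<in> {0..T} \<Longrightarrow> (y has_vector_derivative f t (y t)) (at t within {0..T})"
proof -
  \<comment> \<open>\<open>c\<close> clamps the real line to \<open>{0..T}\<close>. Precomposing
    with it extends a continuous function on the interval to a bounded continuous function on all
    reals, so the iteration can run in the complete space of such functions.\<close>
  define c where "c r = max 0 (min T r)" for r :: real
  have c_in: "c r \<in> {0..T}" for r using T by (auto simp: c_def)
  have c_id: "c t = t" if "t \<in> {0..T}" for t using that by (auto simp: c_def)
  have c_cont: "continuous_on UNIV c" unfolding c_def by (intro continuous_intros)
  \<comment> \<open>\<open>F\<close> is the Picard operator conjugated by the weight \<open>exp (- 2 * L * t)\<close>, which makes it a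
    contraction on the whole interval at once.\<close>
  define F where "F z t = exp (- 2 * L * t) *\<^sub>R
      (y\<^sub>0 + integral {0..t} (\<lambda>s. f s (exp (2 * L * s) *\<^sub>R z s)))" for z :: "real \<Rightarrow> 'a" and t
  have rhs_cont: "continuous_on {0..T} (\<lambda>s. f s (exp (2 * L * s) *\<^sub>R z s))"
    if "continuous_on {0..T} z" for z
  proof -
    have "continuous_on {0..T} ((\<lambda>(t, x). f t x) \<circ> (\<lambda>s. (s, exp (2 * L * s) *\<^sub>R z s)))"
      by (intro continuous_on_compose continuous_intros that continuous_on_subset[OF cont]) auto
    then show ?thesis by (simp add: o_def)
  qed
  have F_cont: "continuous_on {0..T} (F z)" if z: "continuous_on {0..T} z" for z
    unfolding F_def
    by (intro continuous_intros indefinite_integral_continuous_1 integrable_continuous_real rhs_cont z)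
  have F_bcont: "(\<lambda>r. F (apply_bcontfun z) (c r)) \<in> bcontfun" for z
  proof -
    have "continuous_on UNIV (F (apply_bcontfun z) \<circ> c)"
      by (rule continuous_on_compose[OF c_cont], rule continuous_on_subset[OF F_cont])
        (use c_in in auto)
    moreover have "bounded (range (\<lambda>r. F (apply_bcontfun z) (c r)))"
      by (rule bounded_subset[OF compact_imp_bounded[OF compact_continuous_image[OF F_cont]]])
        (use c_in in auto)
    ultimately show ?thesis by (simp add: bcontfun_def o_def)
  qed
  define \<Phi> where "\<Phi> z = Bcontfun (\<lambda>r. F (apply_bcontfun z) (c r))" for z :: "real \<Rightarrow>\<^sub>C 'a"
  have \<Phi>_apply: "apply_bcontfun (\<Phi> z) r = F (apply_bcontfun z) (c r)" for z r
    by (simp add: \<Phi>_def Bcontfun_inverse[OF F_bcont])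
  have contraction: "dist (\<Phi> z1) (\<Phi> z2) \<le> 1/2 * dist z1 z2" for z1 z2
  proof (rule dist_bound)
    fix r :: real
    define t where "t = c r"
    have t: "0 \<le> t" "t \<le> T" using c_in[of r] by (auto simp: t_def)
    define d where "d = dist z1 z2"
    have d: "0 \<le> d" by (simp add: d_def)
    let ?g = "\<lambda>z s. f s (exp (2 * L * s) *\<^sub>R apply_bcontfun z s)"
    have int: "?g z integrable_on {0..t}" for z
      using t by (intro integrable_continuous_real continuous_on_subset[OF rhs_cont]) auto
    \<comment> \<open>The Lipschitz bound times the weight integrates to
      \<open>d / 2 * (exp (2 * L * t) - 1)\<close>. The rate \<open>2 * L\<close>, twice the
      Lipschitz constant, is what makes the contraction factor 1/2.\<close>
    have exp_int: "((\<lambda>s. L * d * exp (2 * L * s)) has_integral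
        (d / 2 * exp (2 * L * t) - d / 2 * exp (2 * L * 0))) {0..t}"
      using t L by (intro fundamental_theorem_of_calculus)
        (auto intro!: derivative_eq_intros
          simp: has_real_derivative_iff_has_vector_derivative[symmetric])
    have "norm (integral {0..t} (\<lambda>s. ?g z1 s - ?g z2 s))
        \<le> integral {0..t} (\<lambda>s. L * d * exp (2 * L * s))"
    proof (rule integral_norm_bound_integral)
      show "(\<lambda>s. ?g z1 s - ?g z2 s) integrable_on {0..t}"
        by (intro integrable_diff int)
      show "(\<lambda>s. L * d * exp (2 * L * s)) integrable_on {0..t}"
        using exp_int by blast
      fix s assume s: "s \<in> {0..t}"
      have "norm (?g z1 s - ?g z2 s)
          \<le> L * norm (exp (2 * L * s) *\<^sub>R apply_bcontfun z1 s - exp (2 * L * s) *\<^sub>R apply_bcontfun z2 s)"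
        using s t by (intro lip) auto
      also have "\<dots> = L * (exp (2 * L * s) * dist (apply_bcontfun z1 s) (apply_bcontfun z2 s))"
        by (simp add: scaleR_diff_right[symmetric] dist_norm)
      also have "\<dots> \<le> L * (exp (2 * L * s) * d)"
        using L by (intro mult_left_mono) (auto simp: d_def dist_bounded)
      finally show "norm (?g z1 s - ?g z2 s) \<le> L * d * exp (2 * L * s)"
        by (simp add: mult_ac)
    qed
    also have "\<dots> = d / 2 * exp (2 * L * t) - d / 2"
      by (subst integral_unique[OF exp_int]) simp
    also have "\<dots> \<le> d / 2 * exp (2 * L * t)" using d by simp
    finally have *: "norm (integral {0..t} (\<lambda>s. ?g z1 s - ?g z2 s)) \<le> d / 2 * exp (2 * L * t)" .
    have "dist (apply_bcontfun (\<Phi> z1) r) (apply_bcontfun (\<Phi> z2) r)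
        = norm (exp (- 2 * L * t) *\<^sub>R integral {0..t} (\<lambda>s. ?g z1 s - ?g z2 s))"
      by (simp add: \<Phi>_apply F_def t_def[symmetric] dist_norm integral_diff[OF int int]
          scaleR_diff_right[symmetric])
    also have "\<dots> = exp (- 2 * L * t) * norm (integral {0..t} (\<lambda>s. ?g z1 s - ?g z2 s))"
      by simp
    also have "\<dots> \<le> exp (- 2 * L * t) * (d / 2 * exp (2 * L * t))"
      using * by (intro mult_left_mono) auto
    also have "\<dots> = 1/2 * d" by (simp add: exp_minus field_simps)
    finally show "dist (apply_bcontfun (\<Phi> z1) r) (apply_bcontfun (\<Phi> z2) r) \<le> 1/2 * dist z1 z2"
      by (simp add: d_def)
  qed
  obtain z where z: "\<Phi> z = z"
    using banach_fix_type[of "1/2" \<Phi>] contraction by auto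
  define y where "y t = exp (2 * L * t) *\<^sub>R apply_bcontfun z t" for t
  have y_eq: "y t = y\<^sub>0 + integral {0..t} (\<lambda>s. f s (y s))" if "t \<in> {0..T}" for t
  proof -
    have "apply_bcontfun z t = F (apply_bcontfun z) t"
      using \<Phi>_apply[of z t] that by (simp add: z c_id)
    then show ?thesis by (simp add: y_def F_def exp_minus)
  qed
  show thesis
  proof
    show "y 0 = y\<^sub>0" using y_eq[of 0] T by simp
    fix t assume t: "t \<in> {0..T}"
    have "continuous_on {0..T} (\<lambda>s. f s (y s))"
      unfolding y_def by (rule rhs_cont) simp
    from integral_has_vector_derivative[OF this t]
    have "((\<lambda>t. y\<^sub>0 + integral {0..t} (\<lambda>s. f s (y s))) has_vector_derivative f t (y t)) (at t within {0..T})"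
      by (auto intro!: derivative_eq_intros)
    then show "(y has_vector_derivative f t (y t)) (at t within {0..T})"
      by (rule has_vector_derivative_transform[OF t, rotated]) (use y_eq in auto)
  qed
qed

section \<open>Barrier arguments and a Gronwall lemma\<close>

text \<open>After the last time \<open>s\<close> at which \<open>f\<close> is at least
  \<open>m\<close>, the function stays below \<open>m\<close>, so it is nondecreasing from
  \<open>s\<close> on and cannot have dropped. The sign of the derivative is asked for only below
  the barrier; this is where the clamped vector field and the equation for \<xi> provide it.\<close>

lemma ge_if_deriv_nonneg_below:
  fixes f :: "real \<Rightarrow> real"
  assumes cont: "continuous_on {a..b} f" and init: "m \<le> f a"
    and deriv: "\<And>t. a < t \<Longrightarrow> t < b \<Longrightarrow> f t < m \<Longrightarrow> \<exists>D. (f has_real_derivative D) (at t) \<and> 0 \<le> D"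
    and t: "t \<in> {a..b}"
  shows "m \<le> f t"
proof (rule ccontr)
  assume below: "\<not> m \<le> f t"
  let ?S = "{a..t} \<inter> f -` {m..}"
  have "continuous_on {a..t} f" using t by (intro continuous_on_subset[OF cont]) auto
  then have "closed ?S" by (intro continuous_closed_preimage) auto
  moreover have S: "?S \<noteq> {}" using init t by auto
  moreover have bdd: "bdd_above ?S" by (rule bdd_aboveI[of _ t]) auto
  ultimately have Sup: "Sup ?S \<in> ?S" by (intro closed_contains_Sup)
  define s where "s = Sup ?S"
  have s: "a \<le> s" "s \<le> t" "m \<le> f s" using Sup by (auto simp: s_def)
  have after: "f r < m" if "s < r" "r \<le> t" for r
  proof (rule ccontr)
    assume "\<not> f r < m"
    then have "r \<in> ?S" using that s by auto
    then have "r \<le> s" unfolding s_def using bdd by (rule cSup_upper)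
    with that show False by simp
  qed
  have "f s \<le> f t"
  proof (rule DERIV_nonneg_imp_increasing_open[OF s(2)])
    show "\<exists>D. (f has_real_derivative D) (at r) \<and> 0 \<le> D" if "s < r" "r < t" for r
      using deriv after that s t by auto
    show "continuous_on {s..t} f" using s t by (intro continuous_on_subset[OF cont]) auto
  qed
  with s below show False by simp
qed

lemma le_if_deriv_nonpos_above:
  fixes f :: "real \<Rightarrow> real"
  assumes cont: "continuous_on {a..b} f" and init: "f a \<le> m"
    and deriv: "\<And>t. a < t \<Longrightarrow> t < b \<Longrightarrow> m < f t \<Longrightarrow> \<exists>D. (f has_real_derivative D) (at t) \<and> D \<le> 0"
    and t: "t \<in> {a..b}"
  shows "f t \<le> m"
proof -
  have "- m \<le> - f t"
  proof (rule ge_if_deriv_nonneg_below[where f = "\<lambda>t. - f t" and a = a and b = b])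
    show "\<exists>D. ((\<lambda>t. - f t) has_real_derivative D) (at t) \<and> 0 \<le> D"
      if r: "a < t" "t < b" "- f t < - m" for t
    proof -
      obtain D where "(f has_real_derivative D) (at t)" "D \<le> 0"
        using deriv[of t] r by auto
      then show ?thesis by (intro exI[of _ "- D"]) (auto intro: DERIV_minus)
    qed
  qed (use assms in \<open>auto intro: continuous_intros\<close>)
  then show ?thesis by simp
qed

text \<open>The product \<open>exp (- K * t) * E t\<close> is nonincreasing and starts at 0. Below,
  \<open>E\<close> is always a square or a sum of squares of differences, so its vanishing means
  that two functions agree.\<close>

lemma gronwall_zero:
  fixes E :: "real \<Rightarrow> real"
  assumes cont: "continuous_on {a..b} E" and init: "E a = 0"
    and nonneg: "\<And>t. t \<in> {a..b} \<Longrightarrow> 0 \<le> E t"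
    and deriv: "\<And>t. a < t \<Longrightarrow> t < b \<Longrightarrow> \<exists>D. (E has_real_derivative D) (at t) \<and> D \<le> K * E t"
    and t: "t \<in> {a..b}"
  shows "E t = 0"
proof -
  have "exp (- K * t) * E t \<le> exp (- K * a) * E a"
  proof (rule DERIV_nonpos_imp_decreasing_open[where f = "\<lambda>t. exp (- K * t) * E t"])
    show "continuous_on {a..t} (\<lambda>t. exp (- K * t) * E t)"
      using t by (intro continuous_intros continuous_on_subset[OF cont]) auto
    fix s assume s: "a < s" "s < t"
    then obtain D where D: "(E has_real_derivative D) (at s)" "D \<le> K * E s"
      using deriv[of s] t by auto
    have "((\<lambda>t. exp (- K * t) * E t) has_real_derivative exp (- K * s) * (D - K * E s)) (at s)"
      by (rule derivative_eq_intros D refl)+ (simp add: algebra_simps)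
    moreover have "exp (- K * s) * (D - K * E s) \<le> 0"
      using D by (simp add: mult_nonneg_nonpos)
    ultimately show "\<exists>D. ((\<lambda>t. exp (- K * t) * E t) has_real_derivative D) (at s) \<and> D \<le> 0" by blast
  qed (use t in auto)
  then have "E t \<le> 0" using init by (simp add: mult_le_0_iff)
  with nonneg[OF t] show ?thesis by simp
qed

section \<open>The phase curve, with \<open>j\<close> as independent variable\<close>

lemma abs_inverse_diff_le:
  fixes m x y :: real
  assumes "0 < m" "m \<le> x" "m \<le> y"
  shows "\<bar>1 / x - 1 / y\<bar> \<le> \<bar>x - y\<bar> / m\<^sup>2"
proof -
  have "1 / x - 1 / y = (y - x) / (x * y)" using assms by (simp add: field_simps)
  then have "\<bar>1 / x - 1 / y\<bar> = \<bar>x - y\<bar> / (x * y)"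
    using assms by (simp add: abs_divide abs_mult abs_minus_commute)
  also have "\<dots> \<le> \<bar>x - y\<bar> / m\<^sup>2"
    using assms by (intro divide_left_mono) (auto simp: power2_eq_square intro!: mult_mono)
  finally show ?thesis .
qed

text \<open>The vector field is singular at \<open>w = 0\<close> and \<open>\<xi> = 0\<close>, so
  both unknowns are first clamped to a compact box away from these lines. The clamped field is
  globally Lipschitz and has a solution on all of \<open>{0..R}\<close>; barrier arguments then show
  that this solution stays in the box, where the clamps do nothing.\<close>

lemma phase_solution_exists:
  fixes G :: "real \<Rightarrow> real"
  assumes pos: "0 < a" "0 < B" "0 < \<xi>\<^sub>0" "0 < R" "0 \<le> A"
    and G_cont: "continuous_on {0..R} G"
    and G_bounds: "\<And>j. j \<in> {0..R} \<Longrightarrow> 0 \<le> G j \<and> G j \<le> A"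
    and m_def: "m = min \<xi>\<^sub>0 (B / (A + B))"
    and small: "a * R < m"
  obtains w \<xi> where "w 0 = 1" "\<xi> 0 = \<xi>\<^sub>0"
    "\<And>j. j \<in> {0..R} \<Longrightarrow> (w has_real_derivative - a / \<xi> j) (at j within {0..R})"
    "\<And>j. j \<in> {0..R} \<Longrightarrow> (\<xi> has_real_derivative - w j * G j + B * (1 - \<xi> j) / (w j * \<xi> j))
       (at j within {0..R})"
    "\<And>j. j \<in> {0..R} \<Longrightarrow> 0 < w j"
    "\<And>j. j \<in> {0..R} \<Longrightarrow> m \<le> \<xi> j \<and> \<xi> j \<le> max \<xi>\<^sub>0 1"
proof -
  define X where "X = max \<xi>\<^sub>0 1"
  \<comment> \<open>The worst case for \<open>w\<close>: with \<xi> at least \<open>m\<close> its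
    slope is at least \<open>- a / m\<close>, so over length \<open>R\<close> it loses at most
    \<open>a * R / m\<close>. The hypothesis \<open>small\<close> says exactly that the remainder is
    positive.\<close>
  define w\<^sub>1 where "w\<^sub>1 = 1 - a * R / m"
  have m: "0 < m" "m \<le> \<xi>\<^sub>0" "m \<le> B / (A + B)" using pos by (auto simp: m_def)
  have "m \<le> X" using m by (simp add: X_def)
  have w\<^sub>1: "0 < w\<^sub>1" "w\<^sub>1 \<le> 1" using m small pos by (auto simp: w\<^sub>1_def field_simps)
  define cw where "cw p = max w\<^sub>1 (min 1 p)" for p :: real
  define cq where "cq q = max m (min X q)" for q :: real
  have cw: "w\<^sub>1 \<le> cw p" "cw p \<le> 1" "0 < cw p" for p using w\<^sub>1 by (auto simp: cw_def)
  have cq: "m \<le> cq q" "cq q \<le> X" "0 < cq q" for q using m \<open>m \<le> X\<close> by (auto simp: cq_def)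
  have cw_lip: "\<bar>cw p - cw p'\<bar> \<le> \<bar>p - p'\<bar>" for p p' by (auto simp: cw_def)
  have cq_lip: "\<bar>cq q - cq q'\<bar> \<le> \<bar>q - q'\<bar>" for q q' by (auto simp: cq_def)
  \<comment> \<open>The clamped field. The term \<open>B * (1 - \<xi>) / (w * \<xi>)\<close> is
    written as a product of functions of the two reciprocals, so that its increments can be split
    factor by factor.\<close>
  define f where "f j z = (- a / cq (snd z), - cw (fst z) * G j + B * ((1 / cq (snd z) - 1) * (1 / cw (fst z))))"
    for j and z :: "real \<times> real"
  \<comment> \<open>Lipschitz constants of the two components: \<open>1 / m\<^sup>2\<close> and
    \<open>1 / w\<^sub>1\<^sup>2\<close> come from the reciprocals on the clamped ranges, and
    \<open>A\<close> from the bound on \<open>G\<close>.\<close>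
  define L\<^sub>1 where "L\<^sub>1 = a / m\<^sup>2"
  define L\<^sub>2 where "L\<^sub>2 = A + B * ((1 / m + 1) / w\<^sub>1\<^sup>2 + 1 / (w\<^sub>1 * m\<^sup>2))"
  have L: "0 < L\<^sub>1" "0 \<le> L\<^sub>2" using pos m w\<^sub>1 by (auto simp: L\<^sub>1_def L\<^sub>2_def)
  have f_lip: "norm (f j z - f j z') \<le> (L\<^sub>1 + L\<^sub>2) * norm (z - z')" if j: "j \<in> {0..R}" for j z z'
  proof -
    define d where "d = norm (z - z')"
    have dp: "\<bar>fst z - fst z'\<bar> \<le> d" and dq: "\<bar>snd z - snd z'\<bar> \<le> d"
      using dist_fst_le[of z z'] dist_snd_le[of z z'] by (simp_all add: d_def dist_norm)
    define h where "h = 1 / cw (fst z)"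
    define h' where "h' = 1 / cw (fst z')"
    define l where "l = 1 / cq (snd z)"
    define l' where "l' = 1 / cq (snd z')"
    note defs = h_def h'_def l_def l'_def
    have l: "\<bar>l - l'\<bar> \<le> d / m\<^sup>2"
    proof -
      have "\<bar>l - l'\<bar> \<le> \<bar>cq (snd z) - cq (snd z')\<bar> / m\<^sup>2"
        unfolding defs by (rule abs_inverse_diff_le) (use m cq in auto)
      also have "\<dots> \<le> d / m\<^sup>2"
        using cq_lip[of "snd z" "snd z'"] dq by (intro divide_right_mono) auto
      finally show ?thesis .
    qed
    have h: "\<bar>h - h'\<bar> \<le> d / w\<^sub>1\<^sup>2"
    proof -
      have "\<bar>h - h'\<bar> \<le> \<bar>cw (fst z) - cw (fst z')\<bar> / w\<^sub>1\<^sup>2"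
        unfolding defs by (rule abs_inverse_diff_le) (use w\<^sub>1 cw in auto)
      also have "\<dots> \<le> d / w\<^sub>1\<^sup>2"
        using cw_lip[of "fst z" "fst z'"] dp by (intro divide_right_mono) auto
      finally show ?thesis .
    qed
    have h_bd: "\<bar>h\<bar> \<le> 1 / w\<^sub>1"
      using cw[of "fst z"] w\<^sub>1 by (simp add: defs frac_le)
    have "0 < l'" "l' \<le> 1 / m" using cq[of "snd z'"] m by (auto simp: defs frac_le)
    then have l_bd: "\<bar>l' - 1\<bar> \<le> 1 / m + 1" by linarith
    have prod: "\<bar>(l - 1) * h - (l' - 1) * h'\<bar> \<le> d / m\<^sup>2 * (1 / w\<^sub>1) + (1 / m + 1) * (d / w\<^sub>1\<^sup>2)"
    proof -
      have "(l - 1) * h - (l' - 1) * h' = (l - l') * h + (l' - 1) * (h - h')"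
        by (simp add: algebra_simps)
      then have "\<bar>(l - 1) * h - (l' - 1) * h'\<bar> \<le> \<bar>l - l'\<bar> * \<bar>h\<bar> + \<bar>l' - 1\<bar> * \<bar>h - h'\<bar>"
        by (metis abs_mult abs_triangle_ineq)
      also have "\<dots> \<le> d / m\<^sup>2 * (1 / w\<^sub>1) + (1 / m + 1) * (d / w\<^sub>1\<^sup>2)"
        using l h h_bd l_bd m by (intro add_mono mult_mono) (auto simp: d_def)
      finally show ?thesis .
    qed
    have Gp: "\<bar>(cw (fst z') - cw (fst z)) * G j\<bar> \<le> d * A"
      unfolding abs_mult using G_bounds[OF j] cw_lip[of "fst z'" "fst z"] dp
      by (intro mult_mono) (auto simp: abs_minus_commute)
    have diff: "f j z - f j z' = (- a * (l - l'),
        (cw (fst z') - cw (fst z)) * G j + B * ((l - 1) * h - (l' - 1) * h'))"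
      by (simp add: f_def defs algebra_simps)
    have "norm (f j z - f j z') \<le> \<bar>- a * (l - l')\<bar>
        + \<bar>(cw (fst z') - cw (fst z)) * G j + B * ((l - 1) * h - (l' - 1) * h')\<bar>"
      unfolding diff real_norm_def[symmetric] by (rule norm_Pair_le)
    also have "\<dots> \<le> a * (d / m\<^sup>2)
        + (d * A + B * (d / m\<^sup>2 * (1 / w\<^sub>1) + (1 / m + 1) * (d / w\<^sub>1\<^sup>2)))"
    proof (rule add_mono)
      show "\<bar>- a * (l - l')\<bar> \<le> a * (d / m\<^sup>2)"
        using mult_left_mono[OF l, of a] pos by (simp add: abs_mult)
      have "\<bar>B * ((l - 1) * h - (l' - 1) * h')\<bar>
          \<le> B * (d / m\<^sup>2 * (1 / w\<^sub>1) + (1 / m + 1) * (d / w\<^sub>1\<^sup>2))"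
        unfolding abs_mult[of B] abs_of_pos[OF pos(2)] using pos by (intro mult_left_mono prod) auto
      with Gp show "\<bar>(cw (fst z') - cw (fst z)) * G j + B * ((l - 1) * h - (l' - 1) * h')\<bar>
          \<le> d * A + B * (d / m\<^sup>2 * (1 / w\<^sub>1) + (1 / m + 1) * (d / w\<^sub>1\<^sup>2))"
        by linarith
    qed
    also have "\<dots> = (L\<^sub>1 + L\<^sub>2) * d"
      by (simp add: L\<^sub>1_def L\<^sub>2_def algebra_simps add_divide_distrib)
    finally show ?thesis by (simp add: d_def)
  qed
  have "continuous_on ({0..R} \<times> UNIV) (\<lambda>z. G (fst z))"
    by (rule continuous_on_compose2[OF G_cont]) (auto intro!: continuous_intros)
  then have f_cont: "continuous_on ({0..R} \<times> UNIV) (\<lambda>(j, z). f j z)"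
    unfolding f_def cw_def cq_def case_prod_beta
    using m w\<^sub>1 by (auto intro!: continuous_intros)
  obtain y where y0: "y 0 = (1, \<xi>\<^sub>0)"
    and y: "\<And>j. j \<in> {0..R} \<Longrightarrow> (y has_vector_derivative f j (y j)) (at j within {0..R})"
    using picard_lindeloef_global[OF _ _ f_cont f_lip, of "(1, \<xi>\<^sub>0)"] pos L by auto
  define w where "w = (\<lambda>j. fst (y j))"
  define \<xi> where "\<xi> = (\<lambda>j. snd (y j))"
  have w': "(w has_real_derivative - a / cq (\<xi> j)) (at j within {0..R})" if "j \<in> {0..R}" for j
    using bounded_linear.has_vector_derivative[OF bounded_linear_fst y[OF that]]
    by (simp add: f_def w_def \<xi>_def has_real_derivative_iff_has_vector_derivative)
  have \<xi>': "(\<xi> has_real_derivative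
      - cw (w j) * G j + B * ((1 / cq (\<xi> j) - 1) * (1 / cw (w j)))) (at j within {0..R})"
    if "j \<in> {0..R}" for j
    using bounded_linear.has_vector_derivative[OF bounded_linear_snd y[OF that]]
    by (simp add: f_def w_def \<xi>_def has_real_derivative_iff_has_vector_derivative)
  have w_cont: "continuous_on {0..R} w" and \<xi>_cont: "continuous_on {0..R} \<xi>"
    by (rule DERIV_continuous_on, erule w') (rule DERIV_continuous_on, erule \<xi>')
  have at: "at j within {0..R} = at j" if "0 < j" "j < R" for j
    using that by (intro at_within_interior) auto
  have w0: "w 0 = 1" and \<xi>0: "\<xi> 0 = \<xi>\<^sub>0" using y0 by (auto simp: w_def \<xi>_def)
  \<comment> \<open>Below the barrier the clamp freezes \<xi> at \<open>m\<close>. As the clamped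
    \<open>w\<close> is at most 1 and \<open>G\<close> at most \<open>A\<close>, the sign of the
    derivative comes down to \<open>m * (A + B) \<le> B\<close>, which is the choice of
    \<open>m\<close>.\<close>
  have \<xi>_ge: "m \<le> \<xi> j" if "j \<in> {0..R}" for j
  proof (rule ge_if_deriv_nonneg_below[OF \<xi>_cont _ _ that])
    show "m \<le> \<xi> 0" using \<xi>0 m by simp
    fix i assume i: "0 < i" "i < R" "\<xi> i < m"
    then have "cq (\<xi> i) = m" using \<open>m \<le> X\<close> by (simp add: cq_def)
    define c where "c = cw (w i)"
    have c: "0 < c" "c \<le> 1" using cw by (auto simp: c_def)
    have Gi: "0 \<le> G i" "G i \<le> A" using G_bounds[of i] i by auto
    have "c\<^sup>2 * G i \<le> 1 * A" using c Gi by (intro mult_mono) (auto simp: power_le_one)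
    then have "m * (c\<^sup>2 * G i) \<le> m * A" using m by (intro mult_left_mono) auto
    moreover have "m * (A + B) \<le> B" using m pos by (simp add: field_simps)
    ultimately have "0 \<le> B * (1 - m) - m * (c\<^sup>2 * G i)" by (simp add: algebra_simps)
    then have "0 \<le> (B * (1 - m) - m * (c\<^sup>2 * G i)) / (m * c)" using m c by simp
    also have "\<dots> = - c * G i + B * ((1 / m - 1) * (1 / c))"
      using m c by (simp add: field_simps power2_eq_square)
    finally show "\<exists>D. (\<xi> has_real_derivative D) (at i) \<and> 0 \<le> D"
      using \<xi>'[of i] i at[of i] \<open>cq (\<xi> i) = m\<close> unfolding c_def by auto
  qed
  \<comment> \<open>Above \<open>X\<close> the clamped value is \<open>X\<close>, which is at least
    1, so the relaxation term is nonpositive just like the term with \<open>G\<close>.\<close>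
  have \<xi>_le: "\<xi> j \<le> X" if "j \<in> {0..R}" for j
  proof (rule le_if_deriv_nonpos_above[OF \<xi>_cont _ _ that])
    show "\<xi> 0 \<le> X" using \<xi>0 by (simp add: X_def)
    fix i assume i: "0 < i" "i < R" "X < \<xi> i"
    then have X: "cq (\<xi> i) = X" using \<open>m \<le> X\<close> by (simp add: cq_def)
    have "1 / X - 1 \<le> 0" by (simp add: X_def)
    then have "B * ((1 / X - 1) * (1 / cw (w i))) \<le> 0"
      using pos cw[of "w i"] by (intro mult_nonneg_nonpos mult_nonpos_nonneg) auto
    moreover have "0 \<le> cw (w i) * G i" using G_bounds[of i] i cw[of "w i"] by auto
    ultimately have "- cw (w i) * G i + B * ((1 / X - 1) * (1 / cw (w i))) \<le> 0" by linarith
    then show "\<exists>D. (\<xi> has_real_derivative D) (at i) \<and> D \<le> 0"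
      using \<xi>'[of i] i at[of i] X by auto
  qed
  have cq_id: "cq (\<xi> j) = \<xi> j" if "j \<in> {0..R}" for j
    using \<xi>_ge[OF that] \<xi>_le[OF that] by (simp add: cq_def)
  have w_le: "w j \<le> 1" if "j \<in> {0..R}" for j
  proof (rule le_if_deriv_nonpos_above[OF w_cont _ _ that])
    show "\<exists>D. (w has_real_derivative D) (at i) \<and> D \<le> 0" if "0 < i" "i < R" "1 < w i" for i
      using w'[of i] that at[of i] pos cq[of "\<xi> i"] by auto
  qed (simp add: w0)
  \<comment> \<open>Comparison with the line of slope \<open>- a / m\<close>, the steepest descent
    that the clamp on \<xi> allows.\<close>
  have w_ge: "w\<^sub>1 \<le> w j" if j: "j \<in> {0..R}" for j
  proof -
    have "w 0 + a / m * 0 \<le> w j + a / m * j"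
    proof (rule DERIV_nonneg_imp_increasing_open[where f = "\<lambda>j. w j + a / m * j"])
      show "continuous_on {0..j} (\<lambda>j. w j + a / m * j)"
        using j by (intro continuous_intros continuous_on_subset[OF w_cont]) auto
      fix i assume i: "0 < i" "i < j"
      have "((\<lambda>j. w j + a / m * j) has_real_derivative (- a / cq (\<xi> i) + a / m)) (at i)"
        using w'[of i] i j at[of i] m(1) by (auto intro!: derivative_eq_intros)
      moreover have "a / cq (\<xi> i) \<le> a / m" using pos m cq[of "\<xi> i"] by (intro divide_left_mono) auto
      ultimately show "\<exists>D. ((\<lambda>j. w j + a / m * j) has_real_derivative D) (at i) \<and> 0 \<le> D"
        by (intro exI conjI) auto
    qed (use j in auto)
    moreover have "a / m * j \<le> a / m * R" using j m pos by (intro mult_left_mono) auto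
    ultimately show ?thesis by (simp add: w0 w\<^sub>1_def)
  qed
  have cw_id: "cw (w j) = w j" if "j \<in> {0..R}" for j
    using w_ge[OF that] w_le[OF that] by (simp add: cw_def)
  show thesis
  proof
    fix j assume j: "j \<in> {0..R}"
    show "(w has_real_derivative - a / \<xi> j) (at j within {0..R})"
      using w'[OF j] by (simp add: cq_id[OF j])
    have "w j > 0" "\<xi> j > 0" using w_ge[OF j] w\<^sub>1 \<xi>_ge[OF j] m by auto
    then have "B * ((1 / \<xi> j - 1) * (1 / w j)) = B * (1 - \<xi> j) / (w j * \<xi> j)"
      by (simp add: field_simps)
    then show "(\<xi> has_real_derivative - w j * G j + B * (1 - \<xi> j) / (w j * \<xi> j)) (at j within {0..R})"
      using \<xi>'[OF j] by (simp add: cq_id[OF j] cw_id[OF j])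
    show "0 < w j" by fact
    show "m \<le> \<xi> j \<and> \<xi> j \<le> max \<xi>\<^sub>0 1" using \<xi>_ge[OF j] \<xi>_le[OF j] by (simp add: X_def)
  qed (use w0 \<xi>0 in auto)
qed

section \<open>The planar system in time: existence, arrival at \<open>R\<close>, and
  uniqueness\<close>

text \<open>
  Here \<open>R = 1 / u\<^sub>0 x\<^sub>0\<close>, \<open>J t\<close> is the integral of \<open>exp (- a s) * \<xi> s\<close> over \<open>[0,t]\<close>, and
  \<open>(exp (- a t))\<^sup>2 * G (J t)\<close> is the space integral of \<open>u\<^sup>2\<close>.
\<close>

definition reduced_solution ::
  "real \<Rightarrow> real \<Rightarrow> (real \<Rightarrow> real) \<Rightarrow> real \<Rightarrow> real \<Rightarrow> real \<Rightarrow> (real \<Rightarrow> real) \<Rightarrow> (real \<Rightarrow> real) \<Rightarrow> bool"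
where
  "reduced_solution a B G R \<xi>\<^sub>0 T J \<xi> \<longleftrightarrow>
     J 0 = 0 \<and> \<xi> 0 = \<xi>\<^sub>0 \<and> continuous_on {0..<T} J \<and> continuous_on {0..<T} \<xi> \<and>
     (\<forall>t\<in>{0..<T}. 0 \<le> J t \<and> J t < R) \<and>
     (\<forall>t\<in>{0<..<T}. (J has_real_derivative exp (- a * t) * \<xi> t) (at t)) \<and>
     (\<forall>t\<in>{0<..<T}.
        (\<xi> has_real_derivative - \<xi> t * ((exp (- a * t))\<^sup>2 * G (J t)) + B * (1 - \<xi> t)) (at t))"

text \<open>The phase curve carries its own clock: \<open>w = exp (- a * t)\<close> determines the
  time at which each \<open>j\<close> is reached, and inverting this increasing map gives
  \<open>J\<close>. The final clause makes \<open>T\<close> the maximal time; it follows because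
  every reduced solution must run along the same phase curve.\<close>

lemma reduced_solution_exists_unique:
  fixes G :: "real \<Rightarrow> real"
  assumes pos: "0 < a" "0 < B" "0 < \<xi>\<^sub>0" "0 < R" "0 \<le> A"
    and G_cont: "continuous_on {0..R} G"
    and G_bounds: "\<And>j. j \<in> {0..R} \<Longrightarrow> 0 \<le> G j \<and> G j \<le> A"
    and m_def: "m = min \<xi>\<^sub>0 (B / (A + B))"
    and small: "a * R < m"
  obtains T J \<xi> where "0 < T" "reduced_solution a B G R \<xi>\<^sub>0 T J \<xi>"
    "J T = R" "continuous_on {0..T} J" "mono_on {0..T} J"
    "\<forall>t\<in>{0..<T}. m \<le> \<xi> t \<and> \<xi> t \<le> max \<xi>\<^sub>0 1"
    "\<forall>S K \<eta>. reduced_solution a B G R \<xi>\<^sub>0 S K \<eta>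
       \<longrightarrow> S \<le> T \<and> (\<forall>t\<in>{0..<S}. K t = J t \<and> \<eta> t = \<xi> t)"
proof -
  have m: "0 < m" "m \<le> \<xi>\<^sub>0" "m \<le> B / (A + B)" using pos by (auto simp: m_def)
  obtain w z where w0: "w 0 = 1" and z0: "z 0 = \<xi>\<^sub>0"
    and w': "\<And>j. j \<in> {0..R} \<Longrightarrow> (w has_real_derivative - a / z j) (at j within {0..R})"
    and z': "\<And>j. j \<in> {0..R} \<Longrightarrow>
      (z has_real_derivative - w j * G j + B * (1 - z j) / (w j * z j)) (at j within {0..R})"
    and w_pos: "\<And>j. j \<in> {0..R} \<Longrightarrow> 0 < w j"
    and z_bounds: "\<And>j. j \<in> {0..R} \<Longrightarrow> m \<le> z j \<and> z j \<le> max \<xi>\<^sub>0 1"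
    using phase_solution_exists[OF pos G_cont G_bounds m_def small] by metis
  have z_pos: "0 < z j" if "j \<in> {0..R}" for j using z_bounds[OF that] m by simp
  have w_cont: "continuous_on {0..R} w" and z_cont: "continuous_on {0..R} z"
    by (rule DERIV_continuous_on, erule w') (rule DERIV_continuous_on, erule z')
  have at: "at j within {0..R} = at j" if "0 < j" "j < R" for j
    using that by (intro at_within_interior) auto
  \<comment> \<open>Solves \<open>w j = exp (- a * t)\<close> for \<open>t\<close>. Its derivative
    \<open>1 / (z j * w j)\<close> is positive, so \<tau> is a strictly increasing bijection from
    \<open>{0..R}\<close> onto \<open>{0..T}\<close>.\<close>
  define \<tau> where "\<tau> j = - ln (w j) / a" for j
  have exp_\<tau>: "exp (- a * \<tau> j) = w j" if "j \<in> {0..R}" for j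
    using w_pos[OF that] pos by (simp add: \<tau>_def)
  have \<tau>_cont: "continuous_on {0..R} \<tau>"
    unfolding \<tau>_def using w_pos pos by (intro continuous_intros w_cont) (auto simp: less_imp_neq[symmetric])
  have \<tau>': "(\<tau> has_real_derivative 1 / (z j * w j)) (at j)" if "0 < j" "j < R" for j
  proof -
    have "(w has_real_derivative - a / z j) (at j)" using w'[of j] at[of j] that by simp
    then show ?thesis
      unfolding \<tau>_def using w_pos[of j] z_pos[of j] that pos
      by (auto intro!: derivative_eq_intros simp: field_simps)
  qed
  have \<tau>_less: "\<tau> i < \<tau> j" if "0 \<le> i" "i < j" "j \<le> R" for i j
  proof (rule DERIV_pos_imp_increasing_open[OF that(2)])
    show "\<exists>D. (\<tau> has_real_derivative D) (at r) \<and> 0 < D" if "i < r" "r < j" for r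
      using \<tau>'[of r] w_pos[of r] z_pos[of r] that \<open>0 \<le> i\<close> \<open>j \<le> R\<close>
      by (intro exI[of _ "1 / (z r * w r)"] conjI) auto
    show "continuous_on {i..j} \<tau>"
      using that by (intro continuous_on_subset[OF \<tau>_cont]) auto
  qed
  have \<tau>_inj: "inj_on \<tau> {0..R}"
    by (rule linorder_inj_onI) (use \<tau>_less in \<open>auto simp: less_imp_neq\<close>)
  define T where "T = \<tau> R"
  have \<tau>0: "\<tau> 0 = 0" by (simp add: \<tau>_def w0)
  have T: "0 < T" using \<tau>_less[of 0 R] pos by (simp add: T_def \<tau>0)
  have \<tau>_le: "\<tau> i \<le> \<tau> j" if "0 \<le> i" "i \<le> j" "j \<le> R" for i j
    using \<tau>_less[of i j] that by (cases "i = j") auto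
  have \<tau>_image: "\<tau> ` {0..R} = {0..T}"
  proof
    show "\<tau> ` {0..R} \<subseteq> {0..T}"
      using \<tau>_le[of 0] \<tau>_le[of _ R] by (auto simp: T_def \<tau>0)
    show "{0..T} \<subseteq> \<tau> ` {0..R}"
      using IVT'[of \<tau> 0 _ R] \<tau>_cont pos by (fastforce simp: T_def \<tau>0)
  qed
  define J where "J = the_inv_into {0..R} \<tau>"
  have J_\<tau>: "J (\<tau> j) = j" if "j \<in> {0..R}" for j
    using the_inv_into_f_f[OF \<tau>_inj that] by (simp add: J_def)
  have \<tau>_J: "\<tau> (J t) = t" if "t \<in> {0..T}" for t
    using f_the_inv_into_f[OF \<tau>_inj] that \<tau>_image by (simp add: J_def)
  have J_in: "J t \<in> {0..R}" if "t \<in> {0..T}" for t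
    using the_inv_into_into[OF \<tau>_inj _ subset_refl, of t] that \<tau>_image by (simp add: J_def)
  have J_cont: "continuous_on {0..T} J"
    using continuous_on_inv[OF \<tau>_cont, of J] J_\<tau> \<tau>_image by simp
  have J0: "J 0 = 0" using J_\<tau>[of 0] pos by (simp add: \<tau>0)
  have JT: "J T = R" using J_\<tau>[of R] pos by (simp add: T_def)
  have J_less: "J s < J t" if "0 \<le> s" "s < t" "t \<le> T" for s t
  proof (rule ccontr)
    assume "\<not> J s < J t"
    then have "\<tau> (J t) \<le> \<tau> (J s)" using J_in[of s] J_in[of t] that by (intro \<tau>_le) auto
    then show False using \<tau>_J[of s] \<tau>_J[of t] that by simp
  qed
  have J': "(J has_real_derivative exp (- a * t) * z (J t)) (at t)" if t: "t \<in> {0<..<T}" for t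
  proof -
    have j: "0 < J t" "J t < R" using J_less[of 0 t] J_less[of t T] t J0 JT by auto
    \<comment> \<open>The inverse function rule gives the derivative \<open>z * w\<close> at
      \<open>J t\<close>; replacing \<open>w (J t)\<close> by \<open>exp (- a * t)\<close> turns it
      into the equation for \<open>J\<close>.\<close>
    have "(J has_real_derivative inverse (1 / (z (J t) * w (J t)))) (at t)"
    proof (rule DERIV_inverse_function[where a = 0 and b = T])
      show "(\<tau> has_real_derivative 1 / (z (J t) * w (J t))) (at (J t))" by (rule \<tau>'[OF j])
      show "1 / (z (J t) * w (J t)) \<noteq> 0" using z_pos[of "J t"] w_pos[of "J t"] j by auto
      show "isCont J t" using continuous_on_interior[OF J_cont, of t] t by simp
    qed (use t \<tau>_J in auto)
    moreover have "exp (- a * t) = w (J t)" using exp_\<tau>[of "J t"] \<tau>_J[of t] j t by simp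
    ultimately show ?thesis by (simp add: mult.commute)
  qed
  show thesis
  proof (rule that[of T J "\<lambda>t. z (J t)"])
    show "reduced_solution a B G R \<xi>\<^sub>0 T J (\<lambda>t. z (J t))"
      unfolding reduced_solution_def
    proof (intro conjI ballI)
      show "continuous_on {0..<T} J" by (rule continuous_on_subset[OF J_cont]) auto
      then show "continuous_on {0..<T} (\<lambda>t. z (J t))"
        by (rule continuous_on_compose2[OF z_cont]) (use J_in in force)
      show "0 \<le> J t" "J t < R" if "t \<in> {0..<T}" for t
        using J_in[of t] J_less[of t T] JT that by auto
      show "(J has_real_derivative exp (- a * t) * z (J t)) (at t)" if "t \<in> {0<..<T}" for t
        using J'[OF that] .
      fix t assume t: "t \<in> {0<..<T}"
      have j: "0 < J t" "J t < R" using J_less[of 0 t] J_less[of t T] t J0 JT by auto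
      have e: "exp (- a * t) = w (J t)" using exp_\<tau>[of "J t"] \<tau>_J[of t] j t by simp
      have "(z has_real_derivative - w (J t) * G (J t) + B * (1 - z (J t)) / (w (J t) * z (J t))) (at (J t))"
        using z'[of "J t"] at[OF j] j by simp
      from DERIV_chain2[OF this J'[OF t]]
      have "((\<lambda>t. z (J t)) has_real_derivative
          (- w (J t) * G (J t) + B * (1 - z (J t)) / (w (J t) * z (J t))) * (w (J t) * z (J t))) (at t)"
        by (simp only: e)
      moreover have "(- w (J t) * G (J t) + B * (1 - z (J t)) / (w (J t) * z (J t))) * (w (J t) * z (J t))
          = - z (J t) * ((w (J t))\<^sup>2 * G (J t)) + B * (1 - z (J t))"
        using z_pos[of "J t"] w_pos[of "J t"] j by (simp add: field_simps power2_eq_square)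
      ultimately show "((\<lambda>t. z (J t)) has_real_derivative
          - z (J t) * ((exp (- a * t))\<^sup>2 * G (J t)) + B * (1 - z (J t))) (at t)" by (simp only: e)
    qed (simp_all add: J0 z0)
    show "mono_on {0..T} J"
    proof (rule mono_onI)
      fix s t assume "s \<in> {0..T}" "t \<in> {0..T}" "s \<le> t"
      then show "J s \<le> J t" using J_less[of s t] by (cases "s = t") auto
    qed
    show "\<forall>t\<in>{0..<T}. m \<le> z (J t) \<and> z (J t) \<le> max \<xi>\<^sub>0 1"
      using z_bounds[OF J_in] by auto
    show "\<forall>S K \<eta>. reduced_solution a B G R \<xi>\<^sub>0 S K \<eta>
       \<longrightarrow> S \<le> T \<and> (\<forall>t\<in>{0..<S}. K t = J t \<and> \<eta> t = z (J t))"
    proof (intro allI impI)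
      fix S K \<eta>
      assume "reduced_solution a B G R \<xi>\<^sub>0 S K \<eta>"
      then have K0: "K 0 = 0" and \<eta>0: "\<eta> 0 = \<xi>\<^sub>0"
        and K_cont: "continuous_on {0..<S} K" and \<eta>_cont: "continuous_on {0..<S} \<eta>"
        and K_in: "\<And>t. t \<in> {0..<S} \<Longrightarrow> 0 \<le> K t \<and> K t < R"
        and K': "\<And>t. t \<in> {0<..<S} \<Longrightarrow> (K has_real_derivative exp (- a * t) * \<eta> t) (at t)"
        and \<eta>': "\<And>t. t \<in> {0<..<S} \<Longrightarrow>
           (\<eta> has_real_derivative - \<eta> t * ((exp (- a * t))\<^sup>2 * G (K t)) + B * (1 - \<eta> t)) (at t)"
        unfolding reduced_solution_def by auto
      have cont: "continuous_on {0..s} K" "continuous_on {0..s} \<eta>" if "s < S" for s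
        using that by (auto intro: continuous_on_subset[OF K_cont] continuous_on_subset[OF \<eta>_cont])
      \<comment> \<open>The lower barrier again, now for an arbitrary reduced solution. It makes
        \<open>K\<close> strictly increasing, so for positive times \<open>K t\<close> lies in the
        open interval, where the phase curve has two-sided derivatives.\<close>
      have \<eta>_ge: "m \<le> \<eta> t" if t: "t \<in> {0..<S}" for t
      proof (rule ge_if_deriv_nonneg_below[of 0 t \<eta>])
        show "continuous_on {0..t} \<eta>" using cont t by simp
        fix s assume s: "0 < s" "s < t" "\<eta> s < m"
        define P where "P = (exp (- a * s))\<^sup>2 * G (K s)"
        have G: "0 \<le> G (K s)" "G (K s) \<le> A" using G_bounds[of "K s"] K_in[of s] s t by auto
        have "(exp (- a * s))\<^sup>2 \<le> 1" using s pos by (simp add: power_le_one)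
        then have P: "0 \<le> P" "P \<le> A"
          using G mult_mono[of "(exp (- a * s))\<^sup>2" 1 "G (K s)" A] by (auto simp: P_def)
        have "0 \<le> - \<eta> s * P + B * (1 - \<eta> s)"
        proof (cases "\<eta> s \<le> 0")
          case True
          then show ?thesis using P pos by (intro add_nonneg_nonneg mult_nonneg_nonneg) auto
        next
          case False
          then have "\<eta> s * P \<le> \<eta> s * A" using P by (intro mult_left_mono) auto
          moreover have "\<eta> s * (A + B) \<le> m * (A + B)" using s pos by (intro mult_right_mono) auto
          moreover have "m * (A + B) \<le> B" using m pos by (simp add: field_simps)
          ultimately show ?thesis by (simp add: algebra_simps)
        qed
        then show "\<exists>D. (\<eta> has_real_derivative D) (at s) \<and> 0 \<le> D"
          using \<eta>'[of s] s t by (auto simp: P_def)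
      qed (use t m \<eta>0 in auto)
      have K_pos: "0 < K t" if t: "0 < t" "t < S" for t
      proof -
        have "K 0 < K t"
        proof (rule DERIV_pos_imp_increasing_open[OF t(1)])
          show "\<exists>D. (K has_real_derivative D) (at s) \<and> 0 < D" if "0 < s" "s < t" for s
            using K'[of s] \<eta>_ge[of s] m that t
            by (intro exI[of _ "exp (- a * s) * \<eta> s"] conjI) auto
        qed (use cont t in auto)
        then show ?thesis by (simp add: K0)
      qed
      have agree: "w (K t) = exp (- a * t) \<and> z (K t) = \<eta> t" if t: "t \<in> {0..<S}" for t
      proof -
        let ?w = "\<lambda>s. exp (- a * s)"
        define D1 D2 where "D1 s = w (K s) - ?w s" and "D2 s = z (K s) - \<eta> s" for s
        \<comment> \<open>Coefficients of the linear system for the differences: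
          \<open>D1' = \<alpha> * D2\<close> and \<open>D2' = \<beta> * D1 - B / z * D2\<close>.
          Both \<open>z\<close> and \<eta> meet \<open>G\<close> at the same point
          \<open>K s\<close>, so no difference of values of \<open>G\<close> arises and its
          continuity suffices for \<beta> to be bounded on \<open>{0..t}\<close>.\<close>
        define \<alpha> where "\<alpha> s = a * ?w s / z (K s)" for s
        define \<beta> where "\<beta> s = - (?w s * \<eta> s * G (K s) + B * \<eta> s * (1 - z (K s)) / (w (K s) * z (K s)))" for s
        have K_R: "K s \<in> {0..R}" if "s \<in> {0..t}" for s using K_in[of s] t that by auto
        have Kt: "continuous_on {0..t} K" "continuous_on {0..t} \<eta>" using cont t by auto
        have comp: "continuous_on {0..t} (\<lambda>s. h (K s))" if "continuous_on {0..R} h" for h :: "real \<Rightarrow> real"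
          by (rule continuous_on_compose2[OF that Kt(1)]) (use K_R in auto)
        have nz: "w (K s) \<noteq> 0" "z (K s) \<noteq> 0" if "s \<in> {0..t}" for s
          using w_pos[OF K_R[OF that]] z_pos[OF K_R[OF that]] by auto
        have "continuous_on {0..t} (\<lambda>s. \<alpha> s + \<beta> s)"
          unfolding \<alpha>_def \<beta>_def using nz
          by (intro continuous_intros comp w_cont z_cont G_cont Kt) auto
        then have "bounded ((\<lambda>s. \<alpha> s + \<beta> s) ` {0..t})"
          by (intro compact_imp_bounded compact_continuous_image) auto
        then obtain C where C: "\<And>s. s \<in> {0..t} \<Longrightarrow> \<bar>\<alpha> s + \<beta> s\<bar> \<le> C"
          unfolding bounded_iff real_norm_def by blast
        have "(D1 t)\<^sup>2 + (D2 t)\<^sup>2 = 0"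
        proof (rule gronwall_zero[of 0 t "\<lambda>s. (D1 s)\<^sup>2 + (D2 s)\<^sup>2" C])
          show "continuous_on {0..t} (\<lambda>s. (D1 s)\<^sup>2 + (D2 s)\<^sup>2)"
            unfolding D1_def D2_def by (intro continuous_intros comp w_cont z_cont Kt)
          show "(D1 0)\<^sup>2 + (D2 0)\<^sup>2 = 0" by (simp add: D1_def D2_def K0 w0 z0 \<eta>0)
          fix s assume s: "0 < s" "s < t"
          then have sS: "s \<in> {0<..<S}" "s \<in> {0..t}" using t by auto
          have k: "0 < K s" "K s < R" using K_pos[of s] K_in[of s] s t by auto
          have w's: "(w has_real_derivative - a / z (K s)) (at (K s))"
            using w'[of "K s"] at[OF k] k by simp
          have z's: "(z has_real_derivative - w (K s) * G (K s) + B * (1 - z (K s)) / (w (K s) * z (K s))) (at (K s))"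
            using z'[of "K s"] at[OF k] k by simp
          have "(D1 has_real_derivative - a / z (K s) * (?w s * \<eta> s) - (- a * ?w s)) (at s)"
            unfolding D1_def
            by (rule derivative_eq_intros DERIV_chain2[OF w's K'[OF sS(1)]] refl)+ simp
          also have "- a / z (K s) * (?w s * \<eta> s) - (- a * ?w s) = \<alpha> s * D2 s"
            using nz[OF sS(2)] by (simp add: \<alpha>_def D2_def field_simps)
          finally have D1': "(D1 has_real_derivative \<alpha> s * D2 s) (at s)" .
          have "(D2 has_real_derivative
              (- w (K s) * G (K s) + B * (1 - z (K s)) / (w (K s) * z (K s))) * (?w s * \<eta> s)
              - (- \<eta> s * ((?w s)\<^sup>2 * G (K s)) + B * (1 - \<eta> s))) (at s)"
            unfolding D2_def
            by (intro DERIV_diff DERIV_chain2[OF z's K'[OF sS(1)]] \<eta>'[OF sS(1)])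
          also have "(- w (K s) * G (K s) + B * (1 - z (K s)) / (w (K s) * z (K s))) * (?w s * \<eta> s)
              - (- \<eta> s * ((?w s)\<^sup>2 * G (K s)) + B * (1 - \<eta> s)) = \<beta> s * D1 s - B / z (K s) * D2 s"
            using nz[OF sS(2)] by (simp add: \<beta>_def D1_def D2_def field_simps power2_eq_square)
          finally have D2': "(D2 has_real_derivative \<beta> s * D1 s - B / z (K s) * D2 s) (at s)" .
          have "((\<lambda>s. (D1 s)\<^sup>2 + (D2 s)\<^sup>2) has_real_derivative
              (2 * D1 s * (\<alpha> s * D2 s) + 2 * D2 s * (\<beta> s * D1 s - B / z (K s) * D2 s))) (at s)"
            by (rule derivative_eq_intros D1' D2' refl)+ (simp add: algebra_simps)
          \<comment> \<open>The cross terms combine to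
            \<open>(\<alpha> + \<beta>) * (2 * D1 * D2)\<close>, controlled by the sum of squares;
            the remaining term in \<open>D2\<close> is damping and is dropped.\<close>
          moreover have "2 * D1 s * (\<alpha> s * D2 s) + 2 * D2 s * (\<beta> s * D1 s - B / z (K s) * D2 s)
              \<le> C * ((D1 s)\<^sup>2 + (D2 s)\<^sup>2)"
          proof -
            have "0 \<le> B / z (K s) * (D2 s)\<^sup>2" using z_pos[of "K s"] k pos by simp
            moreover have "(\<alpha> s + \<beta> s) * (2 * D1 s * D2 s) \<le> C * ((D1 s)\<^sup>2 + (D2 s)\<^sup>2)"
            proof -
              have "(\<alpha> s + \<beta> s) * (2 * D1 s * D2 s) \<le> \<bar>\<alpha> s + \<beta> s\<bar> * \<bar>2 * D1 s * D2 s\<bar>"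
                by (metis abs_ge_self abs_mult)
              also have "\<dots> \<le> C * ((D1 s)\<^sup>2 + (D2 s)\<^sup>2)"
              proof (rule mult_mono)
                show "\<bar>2 * D1 s * D2 s\<bar> \<le> (D1 s)\<^sup>2 + (D2 s)\<^sup>2"
                  using sum_squares_bound[of "D1 s" "D2 s"] sum_squares_bound[of "D1 s" "- D2 s"]
                  by (simp add: abs_le_iff)
                show "0 \<le> C" using C[OF sS(2)] by linarith
              qed (use C[OF sS(2)] in auto)
              finally show ?thesis .
            qed
            moreover have "2 * D1 s * (\<alpha> s * D2 s) + 2 * D2 s * (\<beta> s * D1 s - B / z (K s) * D2 s)
              = (\<alpha> s + \<beta> s) * (2 * D1 s * D2 s) - 2 * (B / z (K s) * (D2 s)\<^sup>2)"
              by (simp add: algebra_simps power2_eq_square)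
            ultimately show ?thesis by linarith
          qed
          ultimately show "\<exists>D. ((\<lambda>s. (D1 s)\<^sup>2 + (D2 s)\<^sup>2) has_real_derivative D) (at s) \<and>
              D \<le> C * ((D1 s)\<^sup>2 + (D2 s)\<^sup>2)" by blast
        qed (use t in auto)
        then show ?thesis by (simp add: D1_def D2_def sum_power2_eq_zero_iff)
      qed
      \<comment> \<open>Since \<open>w (K t) = exp (- a * t)\<close>, the clock reads
        \<open>t\<close> at \<open>K t\<close>. Thus \<open>K\<close> inverts \<tau>, and
        \<open>K t < R\<close> gives \<open>t < T\<close>; if \<open>S\<close> exceeded
        \<open>T\<close>, the choice \<open>t = T\<close> would be contradictory.\<close>
      have \<tau>_K: "\<tau> (K t) = t" if "t \<in> {0..<S}" for t
        using agree[OF that] pos by (simp add: \<tau>_def)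
      have less_T: "t < T" if "t \<in> {0..<S}" for t
        using \<tau>_less[of "K t" R] K_in[OF that] \<tau>_K[OF that] by (simp add: T_def)
      have "S \<le> T"
      proof (rule ccontr)
        assume "\<not> S \<le> T"
        then show False using less_T[of T] T by auto
      qed
      moreover have "K t = J t \<and> \<eta> t = z (J t)" if t: "t \<in> {0..<S}" for t
      proof -
        have "K t = J t" using J_\<tau>[of "K t"] K_in[OF t] \<tau>_K[OF t] by auto
        with agree[OF t] show ?thesis by simp
      qed
      ultimately show "S \<le> T \<and> (\<forall>t\<in>{0..<S}. K t = J t \<and> \<eta> t = z (J t))" by blast
    qed
  qed (use T J0 JT J_cont z0 in auto)
qed

section \<open>The coefficient \<open>G\<close>: domination and continuity up to the
  endpoint\<close>

text \<open>The denominator is smallest at \<open>j = 1 / M\<close>, where it equals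
  \<open>(M - v) / M\<close>. The resulting bound, uniform in \<open>j\<close>, serves both as the
  dominating function for \<open>G\<close> and as the pointwise estimate on
  \<open>u\<close>.\<close>

lemma kernel_bounds:
  fixes M v j :: real
  assumes "0 \<le> v" "v < M" "0 \<le> j" "j \<le> 1 / M"
  shows "0 < 1 - v * j" "0 \<le> v / (1 - v * j)" "v / (1 - v * j) \<le> M * v / (M - v)"
proof -
  have M: "0 < M" using assms by simp
  have "v * j \<le> v * (1 / M)" using assms by (intro mult_left_mono) auto
  then have ge: "(M - v) / M \<le> 1 - v * j" using M by (simp add: field_simps)
  have p: "0 < (M - v) / M" using assms M by simp
  with ge show pos: "0 < 1 - v * j" by linarith
  with assms show "0 \<le> v / (1 - v * j)" by simp
  have "v / (1 - v * j) \<le> v / ((M - v) / M)"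
    using assms ge p pos by (intro divide_left_mono) auto
  then show "v / (1 - v * j) \<le> M * v / (M - v)" by (simp add: mult.commute)
qed

text \<open>Dominated convergence, with the integrand of \<open>A\<^sub>0\<close> as majorant. The
  range condition is only almost everywhere because it fails at the maximum point itself, a null
  set.\<close>

lemma kernel_integral:
  fixes v :: "'a \<Rightarrow> real"
  assumes meas: "v \<in> borel_measurable N" and range: "AE x in N. 0 \<le> v x \<and> v x < M"
    and int: "integrable N (\<lambda>x. (M * v x / (M - v x))\<^sup>2)"
  shows "continuous_on {0..1 / M} (\<lambda>j. LINT x|N. (v x / (1 - v x * j))\<^sup>2)"
    and "\<And>j. j \<in> {0..1 / M} \<Longrightarrow>
      (LINT x|N. (v x / (1 - v x * j))\<^sup>2) \<le> (LINT x|N. (M * v x / (M - v x))\<^sup>2)"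
proof -
  have m[measurable]: "(\<lambda>x. (v x / (1 - v x * j))\<^sup>2) \<in> borel_measurable N" for j
    using meas by measurable
  have bound: "AE x in N. (v x / (1 - v x * j))\<^sup>2 \<le> (M * v x / (M - v x))\<^sup>2" if "j \<in> {0..1 / M}" for j
    using range
  proof eventually_elim
    case (elim x)
    then show ?case using kernel_bounds[of "v x" M j] that by (intro power_mono) auto
  qed
  show "(LINT x|N. (v x / (1 - v x * j))\<^sup>2) \<le> (LINT x|N. (M * v x / (M - v x))\<^sup>2)"
    if j: "j \<in> {0..1 / M}" for j
  proof (rule integral_mono_AE)
    show "integrable N (\<lambda>x. (v x / (1 - v x * j))\<^sup>2)"
      by (rule Bochner_Integration.integrable_bound[OF int m]) (use bound[OF j] in simp)
  qed (use int bound[OF j] in auto)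
  show "continuous_on {0..1 / M} (\<lambda>j. LINT x|N. (v x / (1 - v x * j))\<^sup>2)"
    unfolding continuous_on_sequentially o_def
  proof (intro allI ballI impI, elim conjE)
    fix i :: "nat \<Rightarrow> real" and j
    assume j: "j \<in> {0..1 / M}" and i: "\<forall>n. i n \<in> {0..1 / M}" and lim: "i \<longlonglongrightarrow> j"
    show "(\<lambda>n. LINT x|N. (v x / (1 - v x * i n))\<^sup>2) \<longlonglongrightarrow> (LINT x|N. (v x / (1 - v x * j))\<^sup>2)"
    proof (rule integral_dominated_convergence[OF m m int])
      show "AE x in N. (\<lambda>n. (v x / (1 - v x * i n))\<^sup>2) \<longlonglongrightarrow> (v x / (1 - v x * j))\<^sup>2"
        using range
      proof eventually_elim
        case (elim x)
        then have "1 - v x * j \<noteq> 0" using kernel_bounds(1)[of "v x" M j] j by auto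
        then show ?case by (intro tendsto_intros lim)
      qed
      show "AE x in N. norm ((v x / (1 - v x * i n))\<^sup>2) \<le> (M * v x / (M - v x))\<^sup>2" for n
        using bound[of "i n"] i by simp
    qed
  qed
qed

section \<open>From an arbitrary solution to its representation through \<open>K\<close>\<close>

lemma continuous_on_Ico_if_Icc:
  fixes f :: "real \<Rightarrow> 'a::topological_space"
  assumes "\<And>s. s < b \<Longrightarrow> continuous_on {a..s} f"
  shows "continuous_on {a..<b} f"
  unfolding continuous_on_eq_continuous_within
proof
  fix t assume t: "t \<in> {a..<b}"
  then obtain s where s: "t < s" "s < b" using dense[of t b] by auto
  have "continuous (at t within {a..s}) f"
    using assms[OF s(2)] s t by (simp add: continuous_on_eq_continuous_within)
  moreover have "at t within {a..<b} = at t within {a..s}"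
    by (rule at_within_nhd[of t "{..<s}"]) (use s in auto)
  ultimately show "continuous (at t within {a..<b}) f" by (simp add: continuous_within)
qed

text \<open>With \<open>K\<close> the integral of \<open>exp (- (B + k) * s) * \<eta> s\<close>, the
  defect \<open>D\<close> of the claimed identity, multiplied by the growing exponential, satisfies
  \<open>D' = v * \<eta> * D\<close> with \<open>D 0 = 0\<close>, hence vanishes. The identity is
  kept in product form because \<open>1 - u\<^sub>0 x * K t\<close> is not yet known to be
  nonzero.\<close>

lemma solution_on_representation:
  assumes sol: "solution_on \<Omega> B k u\<^sub>0 \<xi>\<^sub>0 S v \<eta>" and "0 \<le> B" "0 \<le> \<xi>\<^sub>0"
  obtains K where "K 0 = 0" "continuous_on {0..<S} K"
    "\<And>t. t \<in> {0<..<S} \<Longrightarrow> (K has_real_derivative exp (- (B + k) * t) * \<eta> t) (at t)"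
    "\<And>t. t \<in> {0..<S} \<Longrightarrow> 0 \<le> K t"
    "\<And>x t. x \<in> \<Omega> \<Longrightarrow> t \<in> {0..<S} \<Longrightarrow> v x t * (1 - u\<^sub>0 x * K t) = exp (- (B + k) * t) * u\<^sub>0 x"
proof -
  define a where "a = B + k"
  have init: "\<And>x. x \<in> \<Omega> \<Longrightarrow> v x 0 = u\<^sub>0 x" "\<eta> 0 = \<xi>\<^sub>0"
    and v_cont: "\<And>x. x \<in> \<Omega> \<Longrightarrow> continuous_on {0..<S} (v x)"
    and \<eta>_cont: "continuous_on {0..<S} \<eta>"
    and v': "\<And>x t. x \<in> \<Omega> \<Longrightarrow> t \<in> {0<..<S} \<Longrightarrow>
        (v x has_real_derivative (- a * v x t + (v x t)\<^sup>2 * \<eta> t)) (at t)"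
    and \<eta>': "\<And>t. t \<in> {0<..<S} \<Longrightarrow>
        (\<eta> has_real_derivative (- \<eta> t * (LINT x|lebesgue_on \<Omega>. (v x t)\<^sup>2) + B * (1 - \<eta> t))) (at t)"
    using sol unfolding solution_on_def a_def by auto
  \<comment> \<open>Where \<eta> is negative both terms of its equation are nonnegative, the
    integral being one of a square; so 0 is a barrier. This gives \<open>K \<ge> 0\<close>.\<close>
  have \<eta>_nonneg: "0 \<le> \<eta> t" if t: "t \<in> {0..<S}" for t
  proof (rule ge_if_deriv_nonneg_below[of 0 t \<eta>])
    show "continuous_on {0..t} \<eta>" using t by (intro continuous_on_subset[OF \<eta>_cont]) auto
    fix s assume s: "0 < s" "s < t" "\<eta> s < 0"
    have "0 \<le> - \<eta> s * (LINT x|lebesgue_on \<Omega>. (v x s)\<^sup>2) + B * (1 - \<eta> s)"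
      using s \<open>0 \<le> B\<close> by (intro add_nonneg_nonneg mult_nonneg_nonneg) auto
    then show "\<exists>D. (\<eta> has_real_derivative D) (at s) \<and> 0 \<le> D" using \<eta>'[of s] s t by auto
  qed (use t init \<open>0 \<le> \<xi>\<^sub>0\<close> in auto)
  define h where "h = (\<lambda>s. exp (- a * s) * \<eta> s)"
  define K where "K = (\<lambda>t. integral {0..t} h)"
  have h_cont: "continuous_on {0..s} h" if "s < S" for s
    unfolding h_def using that by (intro continuous_intros continuous_on_subset[OF \<eta>_cont]) auto
  have K_cont: "continuous_on {0..s} K" if "s < S" for s
    unfolding K_def by (intro indefinite_integral_continuous_1 integrable_continuous_real h_cont that)
  have K': "(K has_real_derivative exp (- a * t) * \<eta> t) (at t)" if t: "t \<in> {0<..<S}" for t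
  proof -
    obtain s where s: "t < s" "s < S" using dense[of t S] t by auto
    have "(K has_real_derivative h t) (at t within {0..s})"
      unfolding K_def using t s by (intro integral_has_real_derivative h_cont) auto
    moreover have "at t within {0..s} = at t" using t s by (intro at_within_interior) auto
    ultimately show ?thesis by (simp add: h_def)
  qed
  have K0: "K 0 = 0" by (simp add: K_def)
  have repr: "v x t * (1 - u\<^sub>0 x * K t) = exp (- a * t) * u\<^sub>0 x" if x: "x \<in> \<Omega>" and t: "t \<in> {0..<S}" for x t
  proof -
    define D where "D = (\<lambda>s. exp (a * s) * v x s * (1 - u\<^sub>0 x * K s) - u\<^sub>0 x)"
    have cont: "continuous_on {0..t} (v x)" "continuous_on {0..t} \<eta>" "continuous_on {0..t} K"
      using t K_cont by (auto intro: continuous_on_subset[OF v_cont[OF x]] continuous_on_subset[OF \<eta>_cont])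
    have "bounded ((\<lambda>s. v x s * \<eta> s) ` {0..t})"
      by (intro compact_imp_bounded compact_continuous_image continuous_intros cont) auto
    then obtain C where C: "\<And>s. s \<in> {0..t} \<Longrightarrow> \<bar>v x s * \<eta> s\<bar> \<le> C"
      unfolding bounded_iff real_norm_def by blast
    have "(D t)\<^sup>2 = 0"
    proof (rule gronwall_zero[of 0 t "\<lambda>s. (D s)\<^sup>2" "2 * C"])
      show "continuous_on {0..t} (\<lambda>s. (D s)\<^sup>2)"
        unfolding D_def by (intro continuous_intros cont)
      show "(D 0)\<^sup>2 = 0" using init x by (simp add: D_def K0)
      fix s assume s: "0 < s" "s < t"
      then have sS: "s \<in> {0<..<S}" "s \<in> {0..t}" using t by auto
      have e: "exp (a * s) * exp (- a * s) = 1" by (simp flip: exp_add)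
      have "(D has_real_derivative
          (exp (a * s) * a * v x s + exp (a * s) * (- a * v x s + (v x s)\<^sup>2 * \<eta> s)) * (1 - u\<^sub>0 x * K s)
          - exp (a * s) * v x s * (u\<^sub>0 x * (exp (- a * s) * \<eta> s))) (at s)"
        unfolding D_def
        by (rule derivative_eq_intros v'[OF x sS(1)] K'[OF sS(1)] refl)+ (simp add: algebra_simps)
      also have "(exp (a * s) * a * v x s + exp (a * s) * (- a * v x s + (v x s)\<^sup>2 * \<eta> s)) * (1 - u\<^sub>0 x * K s)
          - exp (a * s) * v x s * (u\<^sub>0 x * (exp (- a * s) * \<eta> s))
          = v x s * \<eta> s * (exp (a * s) * v x s * (1 - u\<^sub>0 x * K s))
            - v x s * \<eta> s * u\<^sub>0 x * (exp (a * s) * exp (- a * s))"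
        by (simp add: algebra_simps power2_eq_square)
      also have "\<dots> = v x s * \<eta> s * D s"
        unfolding e by (simp add: D_def algebra_simps)
      finally have D': "(D has_real_derivative v x s * \<eta> s * D s) (at s)" .
      have "((\<lambda>s. (D s)\<^sup>2) has_real_derivative 2 * (v x s * \<eta> s) * (D s)\<^sup>2) (at s)"
        by (rule derivative_eq_intros D' refl)+ (simp add: power2_eq_square)
      moreover have "2 * (v x s * \<eta> s) * (D s)\<^sup>2 \<le> 2 * C * (D s)\<^sup>2"
        using C[OF sS(2)] by (intro mult_right_mono) auto
      ultimately show "\<exists>E. ((\<lambda>s. (D s)\<^sup>2) has_real_derivative E) (at s) \<and> E \<le> 2 * C * (D s)\<^sup>2"
        by blast
    qed (use t in auto)
    then have "exp (a * t) * (v x t * (1 - u\<^sub>0 x * K t)) = u\<^sub>0 x" by (simp add: D_def mult.assoc)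
    then have "exp (- a * t) * u\<^sub>0 x = (exp (- a * t) * exp (a * t)) * (v x t * (1 - u\<^sub>0 x * K t))"
      by (simp add: mult.assoc)
    also have "exp (- a * t) * exp (a * t) = 1" by (simp flip: exp_add)
    finally show ?thesis by simp
  qed
  show thesis
  proof
    show "continuous_on {0..<S} K" by (rule continuous_on_Ico_if_Icc) (rule K_cont)
    show "0 \<le> K t" if "t \<in> {0..<S}" for t
      unfolding K_def
    proof (rule Henstock_Kurzweil_Integration.integral_nonneg)
      show "h integrable_on {0..t}" using that by (intro integrable_continuous_real h_cont) auto
      show "0 \<le> h s" if "s \<in> {0..t}" for s
        using \<eta>_nonneg[of s] that \<open>t \<in> {0..<S}\<close> by (auto simp: h_def)
    qed
  qed (use K0 K' repr in \<open>auto simp: a_def\<close>)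
qed

section \<open>Blow-up for the full system\<close>

theorem theoremC4:
  fixes \<Omega> :: "(real ^ 'n) set" and x\<^sub>0 :: "real ^ 'n" and u\<^sub>0 :: "real ^ 'n \<Rightarrow> real"
    and B k \<xi>\<^sub>0 A\<^sub>0 :: real
  assumes "bounded \<Omega>" and "\<Omega> \<in> sets lebesgue" and "measure lebesgue \<Omega> = 1"
    and "B > 0" and "k > 0"
    and "x\<^sub>0 \<in> \<Omega>"
    and "u\<^sub>0 \<in> borel_measurable (lebesgue_on \<Omega>)" and "bounded (u\<^sub>0 ` \<Omega>)"
    and "\<forall>x\<in>\<Omega> - {x\<^sub>0}. 0 \<le> u\<^sub>0 x \<and> u\<^sub>0 x < u\<^sub>0 x\<^sub>0"
    and "integrable (lebesgue_on \<Omega>) (\<lambda>x. (u\<^sub>0 x\<^sub>0 * u\<^sub>0 x / (u\<^sub>0 x\<^sub>0 - u\<^sub>0 x))\<^sup>2)"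
    and "A\<^sub>0 = (LINT x|lebesgue_on \<Omega>. (u\<^sub>0 x\<^sub>0 * u\<^sub>0 x / (u\<^sub>0 x\<^sub>0 - u\<^sub>0 x))\<^sup>2)"
    and "1 / (B + k) * min \<xi>\<^sub>0 (B / (A\<^sub>0 + B)) > 1 / u\<^sub>0 x\<^sub>0"
  shows "\<exists>Tmax>0. \<exists>u \<xi>.
      maximal_solution \<Omega> B k u\<^sub>0 \<xi>\<^sub>0 Tmax u \<xi> \<and>
      (\<forall>x\<in>\<Omega>. continuous_on {0..<Tmax} (u x)) \<and> continuous_on {0..<Tmax} \<xi> \<and>
      filterlim (u x\<^sub>0) at_top (at_left Tmax) \<and>
      (\<forall>x\<in>\<Omega> - {x\<^sub>0}. \<forall>t\<in>{0..<Tmax}.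
         0 \<le> u x t \<and>
         u x t \<le> u\<^sub>0 x\<^sub>0 * u\<^sub>0 x * exp (- t * (B + k)) / (u\<^sub>0 x\<^sub>0 - u\<^sub>0 x)) \<and>
      (\<forall>t\<in>{0..<Tmax}. min \<xi>\<^sub>0 (B / (A\<^sub>0 + B)) \<le> \<xi> t \<and> \<xi> t \<le> max \<xi>\<^sub>0 1)"
proof -
  define a M N m where "a = B + k" and "M = u\<^sub>0 x\<^sub>0" and "N = lebesgue_on \<Omega>"
    and "m = min \<xi>\<^sub>0 (B / (A\<^sub>0 + B))"
  define G where "G = (\<lambda>j. LINT x|N. (u\<^sub>0 x / (1 - u\<^sub>0 x * j))\<^sup>2)"
  have a: "0 < a" using assms by (simp add: a_def)
  have space: "space N = \<Omega>" by (simp add: N_def space_restrict_space)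
  have u\<^sub>0: "0 \<le> u\<^sub>0 x" "u\<^sub>0 x < M" if "x \<in> \<Omega>" "x \<noteq> x\<^sub>0" for x
    using assms(9) that by (auto simp: M_def)
  \<comment> \<open>A singleton has measure 0, not 1. A second point of \<Omega>, where
    \<open>u\<^sub>0\<close> is nonnegative and below \<open>M\<close>, yields
    \<open>M > 0\<close>.\<close>
  have "\<Omega> \<noteq> {x\<^sub>0}" using assms(3) by auto
  then obtain x\<^sub>1 where "x\<^sub>1 \<in> \<Omega>" "x\<^sub>1 \<noteq> x\<^sub>0" using assms(6) by blast
  then have M: "0 < M" using u\<^sub>0[of x\<^sub>1] by simp
  have u\<^sub>0': "0 \<le> u\<^sub>0 x" "u\<^sub>0 x \<le> M" if "x \<in> \<Omega>" for x
    using u\<^sub>0[of x] M that by (cases "x = x\<^sub>0"; force simp: M_def)+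
  have A: "0 \<le> A\<^sub>0" unfolding assms(11) by (rule Bochner_Integration.integral_nonneg) simp
  have R: "0 < 1 / M" using M by simp
  have small: "a * (1 / M) < m"
    using assms(12) a by (simp add: a_def M_def m_def field_simps)
  moreover have "0 < a * (1 / M)" using a M by simp
  ultimately have "0 < m" by linarith
  then have \<xi>\<^sub>0: "0 < \<xi>\<^sub>0" by (simp add: m_def)
  \<comment> \<open>The point \<open>x\<^sub>0\<close> is null, so the value 0 that division by zero
    assigns there to the integrand of \<open>A\<^sub>0\<close> does not affect the integral.\<close>
  have "AE x in N. x \<noteq> x\<^sub>0"
    unfolding N_def using assms(2) AE_completion[OF AE_lborel_singleton[of x\<^sub>0]]
    by (subst AE_restrict_space_iff) auto
  then have range: "AE x in N. 0 \<le> u\<^sub>0 x \<and> u\<^sub>0 x < M"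
    using AE_space by eventually_elim (use u\<^sub>0 space in auto)
  have meas: "u\<^sub>0 \<in> borel_measurable N" using assms(7) by (simp add: N_def)
  have int: "integrable N (\<lambda>x. (M * u\<^sub>0 x / (M - u\<^sub>0 x))\<^sup>2)"
    using assms(10) by (simp add: N_def M_def)
  have A_eq: "A\<^sub>0 = (LINT x|N. (M * u\<^sub>0 x / (M - u\<^sub>0 x))\<^sup>2)"
    using assms(11) by (simp add: N_def M_def)
  have G_cont: "continuous_on {0..1 / M} G"
    unfolding G_def by (rule kernel_integral(1)[OF meas range int])
  have G_bounds: "0 \<le> G j \<and> G j \<le> A\<^sub>0" if "j \<in> {0..1 / M}" for j
    using kernel_integral(2)[OF meas range int that]
    by (auto simp: G_def A_eq intro!: Bochner_Integration.integral_nonneg)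
  \<comment> \<open>For \<open>j\<close> strictly below \<open>1 / M\<close> the denominator is
    positive at every point of \<Omega>, including \<open>x\<^sub>0\<close>.\<close>
  have denom: "0 < 1 - u\<^sub>0 x * j" if "x \<in> \<Omega>" "0 \<le> j" "j < 1 / M" for x j
  proof -
    have "u\<^sub>0 x * j \<le> M * j" using u\<^sub>0'[OF that(1)] that by (intro mult_right_mono) auto
    also have "\<dots> < 1" using that M by (simp add: field_simps)
    finally show ?thesis by simp
  qed
  obtain T J \<xi> where T: "0 < T" and red: "reduced_solution a B G (1 / M) \<xi>\<^sub>0 T J \<xi>"
    and JT: "J T = 1 / M" and J_cont: "continuous_on {0..T} J" and J_mono: "mono_on {0..T} J"
    and \<xi>_bounds: "\<forall>t\<in>{0..<T}. m \<le> \<xi> t \<and> \<xi> t \<le> max \<xi>\<^sub>0 1"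
    and unique: "\<forall>S K \<eta>. reduced_solution a B G (1 / M) \<xi>\<^sub>0 S K \<eta>
       \<longrightarrow> S \<le> T \<and> (\<forall>t\<in>{0..<S}. K t = J t \<and> \<eta> t = \<xi> t)"
    by (rule reduced_solution_exists_unique[OF a assms(4) \<xi>\<^sub>0 R A G_cont G_bounds m_def small])
  have J0: "J 0 = 0" and \<xi>0: "\<xi> 0 = \<xi>\<^sub>0"
    and cont_Ico: "continuous_on {0..<T} J" "continuous_on {0..<T} \<xi>"
    and J_in: "\<And>t. t \<in> {0..<T} \<Longrightarrow> 0 \<le> J t \<and> J t < 1 / M"
    and J': "\<And>t. t \<in> {0<..<T} \<Longrightarrow> (J has_real_derivative exp (- a * t) * \<xi> t) (at t)"
    and \<xi>': "\<And>t. t \<in> {0<..<T} \<Longrightarrow>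
       (\<xi> has_real_derivative - \<xi> t * ((exp (- a * t))\<^sup>2 * G (J t)) + B * (1 - \<xi> t)) (at t)"
    using red unfolding reduced_solution_def by auto
  define u where "u = (\<lambda>x t. exp (- a * t) * u\<^sub>0 x / (1 - u\<^sub>0 x * J t))"
  \<comment> \<open>Stated for a general \<open>v\<close> and \<open>j\<close>, to be used both for
    the constructed solution and for a competing one.\<close>
  have square_integral: "(LINT x|lebesgue_on \<Omega>. (v x)\<^sup>2) = (exp (- a * t))\<^sup>2 * G j"
    if "\<And>x. x \<in> \<Omega> \<Longrightarrow> v x = exp (- a * t) * u\<^sub>0 x / (1 - u\<^sub>0 x * j)" for v t j
  proof -
    have "(LINT x|N. (v x)\<^sup>2) = (LINT x|N. (exp (- a * t))\<^sup>2 * (u\<^sub>0 x / (1 - u\<^sub>0 x * j))\<^sup>2)"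
      by (rule Bochner_Integration.integral_cong)
        (use that space in \<open>auto simp: power_mult_distrib power_divide\<close>)
    then show ?thesis by (simp add: G_def N_def)
  qed
  have denom_J: "0 < 1 - u\<^sub>0 x * J t" if "x \<in> \<Omega>" "t \<in> {0..<T}" for x t
    using denom[OF that(1)] J_in[OF that(2)] by auto
  have u_cont: "continuous_on {0..<T} (u x)" if "x \<in> \<Omega>" for x
    unfolding u_def using denom_J[OF that] by (intro continuous_intros cont_Ico) force
  have solution: "solution_on \<Omega> B k u\<^sub>0 \<xi>\<^sub>0 T u \<xi>"
    unfolding solution_on_def
  proof (intro conjI ballI)
    show "u x 0 = u\<^sub>0 x" for x by (simp add: u_def J0)
    show "\<xi> 0 = \<xi>\<^sub>0" by fact
    show "continuous_on {0..<T} (u x)" if "x \<in> \<Omega>" for x using u_cont[OF that] .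
    show "continuous_on {0..<T} \<xi>" by (fact cont_Ico)
    show "(\<lambda>x. u x t) \<in> borel_measurable (lebesgue_on \<Omega>)" for t
      using assms(7) unfolding u_def by measurable
  next
    fix S assume S: "S \<in> {0..<T}"
    show "\<exists>C. \<forall>x\<in>\<Omega>. \<forall>t\<in>{0..S}. \<bar>u x t\<bar> \<le> C"
    proof (intro exI ballI)
      fix x t assume x: "x \<in> \<Omega>" and t: "t \<in> {0..S}"
      \<comment> \<open>The bound on \<open>{0..S}\<close> is the worst case in both variables: the
        largest initial value \<open>M\<close>, and the last time \<open>S\<close>, since
        \<open>J\<close> is monotone.\<close>
      have JS: "0 < 1 - M * J S" using denom_J[OF assms(6) S] by (simp add: M_def)
      have Jt: "0 \<le> J t" "J t \<le> J S"
        using J_in[of t] S t by (auto intro: mono_onD[OF J_mono])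
      have "u\<^sub>0 x * J t \<le> M * J S" using u\<^sub>0'[OF x] Jt M by (intro mult_mono) auto
      moreover have "exp (- a * t) * u\<^sub>0 x \<le> 1 * M"
        using a t u\<^sub>0'[OF x] by (intro mult_mono) auto
      ultimately have "u x t \<le> M / (1 - M * J S)"
        unfolding u_def using JS M u\<^sub>0'[OF x] by (intro frac_le) auto
      moreover have "0 \<le> u x t"
        unfolding u_def using denom_J[OF x, of t] S t u\<^sub>0'[OF x] by (intro divide_nonneg_nonneg) auto
      ultimately show "\<bar>u x t\<bar> \<le> M / (1 - M * J S)" by simp
    qed
  next
    fix x t assume x: "x \<in> \<Omega>" and t: "t \<in> {0<..<T}"
    have nz: "1 - u\<^sub>0 x * J t \<noteq> 0" using denom_J[OF x, of t] t by auto
    have "(u x has_real_derivative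
        ((exp (- a * t) * (- a) * u\<^sub>0 x) * (1 - u\<^sub>0 x * J t)
          - exp (- a * t) * u\<^sub>0 x * (- (u\<^sub>0 x * (exp (- a * t) * \<xi> t))))
        / ((1 - u\<^sub>0 x * J t) * (1 - u\<^sub>0 x * J t))) (at t)"
      unfolding u_def using nz
      by (auto intro!: derivative_eq_intros J'[OF t])
    also have "((exp (- a * t) * (- a) * u\<^sub>0 x) * (1 - u\<^sub>0 x * J t)
          - exp (- a * t) * u\<^sub>0 x * (- (u\<^sub>0 x * (exp (- a * t) * \<xi> t))))
        / ((1 - u\<^sub>0 x * J t) * (1 - u\<^sub>0 x * J t)) = - a * u x t + (u x t)\<^sup>2 * \<xi> t"
      unfolding u_def diff_divide_distrib using nz by (simp add: power2_eq_square mult_ac)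
    finally show "(u x has_real_derivative (- (B + k) * u x t + (u x t)\<^sup>2 * \<xi> t)) (at t)"
      by (simp add: a_def)
  next
    fix t assume t: "t \<in> {0<..<T}"
    have "(LINT x|lebesgue_on \<Omega>. (u x t)\<^sup>2) = (exp (- a * t))\<^sup>2 * G (J t)"
      by (rule square_integral) (simp add: u_def)
    then show "(\<xi> has_real_derivative
        (- \<xi> t * (LINT x|lebesgue_on \<Omega>. (u x t)\<^sup>2) + B * (1 - \<xi> t))) (at t)"
      using \<xi>'[OF t] by simp
  qed
  have maximal: "S \<le> T \<and> (\<forall>t\<in>{0..<S}. \<eta> t = \<xi> t \<and> (\<forall>x\<in>\<Omega>. v x t = u x t))"
    if sol: "solution_on \<Omega> B k u\<^sub>0 \<xi>\<^sub>0 S v \<eta>" for S v \<eta>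
  proof -
    obtain K where K0: "K 0 = 0" and K_cont: "continuous_on {0..<S} K"
      and K': "\<And>t. t \<in> {0<..<S} \<Longrightarrow> (K has_real_derivative exp (- a * t) * \<eta> t) (at t)"
      and K_nonneg: "\<And>t. t \<in> {0..<S} \<Longrightarrow> 0 \<le> K t"
      and repr: "\<And>x t. x \<in> \<Omega> \<Longrightarrow> t \<in> {0..<S} \<Longrightarrow> v x t * (1 - u\<^sub>0 x * K t) = exp (- a * t) * u\<^sub>0 x"
      using solution_on_representation[OF sol less_imp_le[OF assms(4)] less_imp_le[OF \<xi>\<^sub>0]]
      unfolding a_def by metis
    \<comment> \<open>At \<open>x\<^sub>0\<close> the representation would read
      \<open>0 = exp (- a * t) * M\<close> if \<open>K t\<close> were \<open>1 / M\<close>. Since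
      \<open>K\<close> starts at 0 and is continuous, it can never pass this value.\<close>
    have K_ne: "K t \<noteq> 1 / M" if "t \<in> {0..<S}" for t
      using repr[OF assms(6) that] M by (auto simp: M_def)
    have K_less: "K t < 1 / M" if t: "t \<in> {0..<S}" for t
    proof (rule ccontr)
      assume "\<not> K t < 1 / M"
      moreover have "continuous_on {0..t} K"
        using t by (intro continuous_on_subset[OF K_cont]) auto
      ultimately obtain s where "0 \<le> s" "s \<le> t" "K s = 1 / M"
        using IVT'[of K 0 "1 / M" t] t M K0 by auto
      then show False using K_ne[of s] t by auto
    qed
    have v_eq: "v x t = exp (- a * t) * u\<^sub>0 x / (1 - u\<^sub>0 x * K t)" if "x \<in> \<Omega>" "t \<in> {0..<S}" for x t
      using repr[OF that] denom[OF that(1) K_nonneg[OF that(2)] K_less[OF that(2)]]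
      by (simp add: nonzero_eq_divide_eq)
    have \<eta>0: "\<eta> 0 = \<xi>\<^sub>0" and \<eta>_cont: "continuous_on {0..<S} \<eta>"
      and \<eta>'_raw: "\<And>t. t \<in> {0<..<S} \<Longrightarrow>
        (\<eta> has_real_derivative (- \<eta> t * (LINT x|lebesgue_on \<Omega>. (v x t)\<^sup>2) + B * (1 - \<eta> t))) (at t)"
      using sol unfolding solution_on_def by auto
    have \<eta>': "(\<eta> has_real_derivative - \<eta> t * ((exp (- a * t))\<^sup>2 * G (K t)) + B * (1 - \<eta> t)) (at t)"
      if t: "t \<in> {0<..<S}" for t
    proof -
      have "(LINT x|lebesgue_on \<Omega>. (v x t)\<^sup>2) = (exp (- a * t))\<^sup>2 * G (K t)"
        by (rule square_integral) (use v_eq t in auto)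
      then show ?thesis using \<eta>'_raw[OF t] by simp
    qed
    \<comment> \<open>Now \<open>K\<close> and \<eta> form a reduced solution, so the planar
      uniqueness applies; \<open>v\<close> is then determined by \<open>K\<close>.\<close>
    have "S \<le> T \<and> (\<forall>t\<in>{0..<S}. K t = J t \<and> \<eta> t = \<xi> t)"
      using K_nonneg K_less K0 \<eta>0 K_cont \<eta>_cont K' \<eta>'
      by (intro unique[rule_format]) (auto simp: reduced_solution_def)
    then show ?thesis by (auto simp: v_eq u_def)
  qed
  have blow_up: "filterlim (u x\<^sub>0) at_top (at_left T)"
  proof -
    have "(J \<longlongrightarrow> 1 / M) (at T within {0..T})"
      using J_cont T unfolding continuous_on JT[symmetric] by auto
    then have J_lim: "(J \<longlongrightarrow> 1 / M) (at_left T)" using T by (simp add: at_within_Icc_at_left)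
    \<comment> \<open>At \<open>x\<^sub>0\<close> the numerator tends to a positive limit, while the
      denominator tends to 0 through positive values as \<open>J\<close> approaches
      \<open>1 / M\<close>.\<close>
    have "filterlim (\<lambda>t. exp (- a * t) * M / (1 - M * J t)) at_top (at_left T)"
    proof (rule LIM_at_top_divide)
      show "((\<lambda>t. exp (- a * t) * M) \<longlongrightarrow> exp (- a * T) * M) (at_left T)"
        by (intro tendsto_intros)
      show "0 < exp (- a * T) * M" using M by simp
      have "((\<lambda>t. 1 - M * J t) \<longlongrightarrow> 1 - M * (1 / M)) (at_left T)"
        by (intro tendsto_intros J_lim)
      then show "((\<lambda>t. 1 - M * J t) \<longlongrightarrow> 0) (at_left T)" using M by simp
      have "\<forall>\<^sub>F t in at_left T. t \<in> {0<..<T}" by (rule eventually_at_leftI[OF _ T])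
      then show "\<forall>\<^sub>F t in at_left T. 0 < 1 - M * J t"
        by eventually_elim (use denom_J[OF assms(6)] in \<open>auto simp: M_def\<close>)
    qed
    then show ?thesis by (simp add: u_def M_def)
  qed
  have estimate: "0 \<le> u x t \<and> u x t \<le> u\<^sub>0 x\<^sub>0 * u\<^sub>0 x * exp (- t * (B + k)) / (u\<^sub>0 x\<^sub>0 - u\<^sub>0 x)"
    if x: "x \<in> \<Omega> - {x\<^sub>0}" and t: "t \<in> {0..<T}" for x t
  proof -
    have u_eq: "u x t = exp (- a * t) * (u\<^sub>0 x / (1 - u\<^sub>0 x * J t))" by (simp add: u_def)
    have kb: "0 \<le> u\<^sub>0 x / (1 - u\<^sub>0 x * J t)" "u\<^sub>0 x / (1 - u\<^sub>0 x * J t) \<le> M * u\<^sub>0 x / (M - u\<^sub>0 x)"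
      using kernel_bounds[of "u\<^sub>0 x" M "J t"] u\<^sub>0[of x] x J_in[OF t] by auto
    have "u x t \<le> exp (- a * t) * (M * u\<^sub>0 x / (M - u\<^sub>0 x))"
      unfolding u_eq using kb by (intro mult_left_mono) auto
    moreover have "0 \<le> u x t" unfolding u_eq by (intro mult_nonneg_nonneg kb) simp
    moreover have "exp (- t * (B + k)) = exp (- a * t)" by (simp add: a_def algebra_simps)
    ultimately show ?thesis by (simp only: M_def) (simp add: mult_ac)
  qed
  show ?thesis
  proof (intro exI conjI)
    show "maximal_solution \<Omega> B k u\<^sub>0 \<xi>\<^sub>0 T u \<xi>"
      unfolding maximal_solution_def using solution maximal by blast
  qed (use T u_cont cont_Ico blow_up estimate \<xi>_bounds in \<open>auto simp: m_def\<close>)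
qed

end
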